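(* There is a simple $2$-tardy c.e. set $A$ with $A''\equiv_T \emptyset''$ (i.e. $A$ is low$_2$).
   Context: Sets are subsets of $\omega$; $\{W_{e}\}_{e\in\omega}$ is the standard listing of the c.e. sets with standard stagewise enumeration $\{W_{e,s}\}_{s\in\omega}$ (only numbers less than $s$ belong to $W_{e,s}$). $\overline{A}=\omega\setminus A$; $A''$ is the double Turing jump. A c.e. set $A$ is simple if $\overline{A}$ is infinite and $A$ meets every infinite c.e. set. $2$-c.e. sets: a set $X$ is $2$-c.e. iff $X=X_1-X_2$ for some c.e. sets $X_1,X_2$. Fix an effective listing of all such presentations (pairs $W_{e_1},W_{e_2}$ of c.e. sets given by indices); $X^2_e=W_{e_1}-W_{e_2}$ denotes the $e$-th $2$-c.e. set in this listing, and $X^2_{e,s}=W_{e_1,s}-W_{e_2,s}$ its stage-$s$ approximation. $2$-tardy: let $A$ be c.e. with a computable enumeration $\{A_s\}_{s\in\omega}$. $A$ is $2$-tardy iff for every nondecreasing total computable function $p$ there is an $e$ such that $X^2_e=\overline{A}$ and, for all $x$ and all $s$, $x\in X^2_{e,s}$ implies $x\notin A_{p(s)}$. (This does not depend on the choice of enumeration of $A$.) *)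

theory Defs
  imports Main "HOL-Library.Nat_Bijection"
begin

text \<open>
  Oracle computability is based on Kleene's schemata (zero, successor, projections, oracle query,
  composition, primitive recursion, unbounded search). All functions are unary on \<open>nat\<close>, and several
  arguments are passed through the Cantor pairing \<^const>\<open>prod_encode\<close>, so that programs
  carry no arities.
\<close>

datatype prog =
    Zero | Succ | Fst | Snd | Query
  | Pair prog prog
  | Comp prog prog
  | Prec prog prog
  | Mu prog

text \<open>
  \<open>run A s c x\<close> runs \<open>c\<close> on input \<open>x\<close> with oracle \<open>A\<close> and nesting depth of calls at most \<open>s\<close>;
  \<open>None\<close> means that no value has been obtained within this bound.
  \<open>Prec f g\<close> maps \<open>(a, 0)\<close> to \<open>f a\<close> and \<open>(a, n + 1)\<close> to \<open>g (a, (n, r))\<close>, where \<open>r\<close> is its value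
  at \<open>(a, n)\<close>. \<open>Mu f\<close> maps \<open>(a, m)\<close> to the least \<open>n \<ge> m\<close> with \<open>f (a, n) = 0\<close>, provided \<open>f (a, i)\<close>
  is defined for all \<open>i\<close> with \<open>m \<le> i < n\<close>.
\<close>

fun run :: "nat set \<Rightarrow> nat \<Rightarrow> prog \<Rightarrow> nat \<Rightarrow> nat option" where
  "run A 0 c x = None"
| "run A (Suc s) Zero x = Some 0"
| "run A (Suc s) Succ x = Some (Suc x)"
| "run A (Suc s) Fst x = Some (fst (prod_decode x))"
| "run A (Suc s) Snd x = Some (snd (prod_decode x))"
| "run A (Suc s) Query x = Some (if x \<in> A then 1 else 0)"
| "run A (Suc s) (Pair f g) x =
     (case run A s f x of None \<Rightarrow> None
      | Some u \<Rightarrow> (case run A s g x of None \<Rightarrow> None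
        | Some v \<Rightarrow> Some (prod_encode (u, v))))"
| "run A (Suc s) (Comp f g) x =
     (case run A s g x of None \<Rightarrow> None | Some u \<Rightarrow> run A s f u)"
| "run A (Suc s) (Prec f g) x =
     (case prod_decode x of (a, k) \<Rightarrow>
       (case k of 0 \<Rightarrow> run A s f a
        | Suc n \<Rightarrow> (case run A s (Prec f g) (prod_encode (a, n)) of None \<Rightarrow> None
          | Some r \<Rightarrow> run A s g (prod_encode (a, prod_encode (n, r))))))"
| "run A (Suc s) (Mu f) x =
     (case prod_decode x of (a, m) \<Rightarrow>
       (case run A s f x of None \<Rightarrow> None
        | Some 0 \<Rightarrow> Some m
        | Some (Suc _) \<Rightarrow> run A s (Mu f) (prod_encode (a, Suc m))))"

lemma run_Suc: "run A s c x = Some y \<Longrightarrow> run A (Suc s) c x = Some y"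
proof (induction s arbitrary: c x y)
  case (Suc s)
  have "run A (Suc t) c x = Some y"
    if "\<And>c x y. run A s c x = Some y \<Longrightarrow> run A t c x = Some y" for t
    using Suc.prems
    by (cases c) (auto split: option.splits prod.splits nat.splits dest!: that)
  then show ?case using Suc.IH by blast
qed simp

lemma run_mono:
  assumes "run A s c x = Some y" and "s \<le> t"
  shows "run A t c x = Some y"
  using assms(2) by (induction rule: dec_induct) (use assms(1) run_Suc in auto)

text \<open>
  The effective Goedel numbering of programs. It is written out explicitly because the abstract
  coding \<open>to_nat\<close> of countable types is not effective.
\<close>

fun prog_code :: "prog \<Rightarrow> nat" where
  "prog_code Zero = 0"
| "prog_code Succ = 1"
| "prog_code Fst = 2"
| "prog_code Snd = 3"
| "prog_code Query = 4"
| "prog_code (Pair f g) = 5 + 4 * prod_encode (prog_code f, prog_code g)"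
| "prog_code (Comp f g) = 6 + 4 * prod_encode (prog_code f, prog_code g)"
| "prog_code (Prec f g) = 7 + 4 * prod_encode (prog_code f, prog_code g)"
| "prog_code (Mu f) = 8 + 4 * prog_code f"

lemma inj_prog_code: "inj prog_code"
proof (rule injI)
  have neq: "4 * m \<noteq> 1 + 4 * n" "4 * m \<noteq> 2 + 4 * n" "4 * m \<noteq> 3 + 4 * n" for m n :: nat
    by presburger+
  have neq': "1 + 4 * n \<noteq> 4 * m" "2 + 4 * n \<noteq> 4 * m" "3 + 4 * n \<noteq> 4 * m" for m n :: nat
    by presburger+
  note neqs = neq neq' neq[simplified] neq'[simplified]
  show "c = d" if "prog_code c = prog_code d" for c d
    using that
  proof (induction c arbitrary: d)
    case Zero then show ?case by (cases d) simp_all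
  next
    case Succ then show ?case by (cases d) simp_all
  next
    case Fst then show ?case by (cases d) simp_all
  next
    case Snd then show ?case by (cases d) simp_all
  next
    case Query then show ?case by (cases d) simp_all
  next
    case (Pair f g) then show ?case by (cases d) (simp_all add: neqs)
  next
    case (Comp f g) then show ?case by (cases d) (simp_all add: neqs)
  next
    case (Prec f g) then show ?case by (cases d) (simp_all add: neqs)
  next
    case (Mu f) then show ?case by (cases d) (simp_all add: neqs)
  qed
qed

lemma surj_prog_code: "surj prog_code"
proof -
  have "\<exists>c. prog_code c = e" for e
  proof (induction e rule: less_induct)
    case (less e)
    show ?case
    proof (cases "e < 5")
      case True
      then have "e = 0 \<or> e = 1 \<or> e = 2 \<or> e = 3 \<or> e = 4" by presburger
      then show ?thesis using prog_code.simps(1-5) by blast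
    next
      case False
      define n where "n = (e - 5) div 4"
      have e: "e = 5 + 4 * n \<or> e = 6 + 4 * n \<or> e = 7 + 4 * n \<or> e = 8 + 4 * n"
        using False unfolding n_def by presburger
      then have "n < e" by linarith
      obtain i j where n: "n = prod_encode (i, j)"
        by (metis prod.exhaust prod_decode_inverse)
      have "i < e" "j < e"
        using \<open>n < e\<close> le_prod_encode_1[of i j] le_prod_encode_2[of j i] n by linarith+
      then obtain f g h where "prog_code f = i" "prog_code g = j" "prog_code h = n"
        using less.IH \<open>n < e\<close> by blast
      then have "prog_code (Pair f g) = 5 + 4 * n" "prog_code (Comp f g) = 6 + 4 * n"
        "prog_code (Prec f g) = 7 + 4 * n" "prog_code (Mu h) = 8 + 4 * n"
        by (simp_all add: n)
      with e show ?thesis by metis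
    qed
  qed
  then show ?thesis by (metis surjI)
qed

lemma bij_prog_code: "bij prog_code"
  using inj_prog_code surj_prog_code by (rule bijI)

definition program :: "nat \<Rightarrow> prog" where
  "program = inv prog_code"

definition computes :: "nat set \<Rightarrow> nat \<Rightarrow> nat \<Rightarrow> nat \<Rightarrow> bool" where
  "computes A e x y \<longleftrightarrow> (\<exists>s. run A s (program e) x = Some y)"

lemma computes_unique: "computes A e x y \<Longrightarrow> computes A e x z \<Longrightarrow> y = z"
proof -
  assume "computes A e x y" "computes A e x z"
  then obtain s t where "run A s (program e) x = Some y" "run A t (program e) x = Some z"
    unfolding computes_def by blast
  then have "run A (max s t) (program e) x = Some y" "run A (max s t) (program e) x = Some z"
    by (blast intro: run_mono max.cobounded1 max.cobounded2)+
  then show ?thesis by simp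
qed

text \<open>Computability without oracle is computability relative to the empty oracle.\<close>

definition computable_fun :: "(nat \<Rightarrow> nat) \<Rightarrow> bool" where
  "computable_fun f \<longleftrightarrow> (\<exists>e. \<forall>x. computes {} e x (f x))"

definition W :: "nat \<Rightarrow> nat set" where
  "W e = {x. \<exists>y. computes {} e x y}"

definition W_stage :: "nat \<Rightarrow> nat \<Rightarrow> nat set" where
  "W_stage e s = {x. x < s \<and> (\<exists>y. run {} s (program e) x = Some y)}"

lemma W_stage_mono: "s \<le> t \<Longrightarrow> W_stage e s \<subseteq> W_stage e t"
  unfolding W_stage_def by (blast intro: run_mono less_le_trans)

lemma W_eq_Union_W_stage: "W e = (\<Union>s. W_stage e s)"
proof
  show "W e \<subseteq> (\<Union>s. W_stage e s)"
  proof
    fix x assume "x \<in> W e"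
    then obtain s y where "run {} s (program e) x = Some y"
      by (auto simp: W_def computes_def)
    then have "run {} (max s (Suc x)) (program e) x = Some y"
      by (rule run_mono) simp
    then have "x \<in> W_stage e (max s (Suc x))"
      unfolding W_stage_def by simp
    then show "x \<in> (\<Union>s. W_stage e s)" by blast
  qed
qed (auto simp: W_def W_stage_def computes_def)

definition ce :: "nat set \<Rightarrow> bool" where
  "ce A \<longleftrightarrow> (\<exists>e. A = W e)"

definition simple_set :: "nat set \<Rightarrow> bool" where
  "simple_set A \<longleftrightarrow> ce A \<and> infinite (- A) \<and> (\<forall>B. ce B \<and> infinite B \<longrightarrow> A \<inter> B \<noteq> {})"

definition turing_le :: "nat set \<Rightarrow> nat set \<Rightarrow> bool" where
  "turing_le A B \<longleftrightarrow> (\<exists>e. \<forall>x. computes B e x (if x \<in> A then 1 else 0))"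

definition turing_equiv :: "nat set \<Rightarrow> nat set \<Rightarrow> bool" where
  "turing_equiv A B \<longleftrightarrow> turing_le A B \<and> turing_le B A"

definition jump :: "nat set \<Rightarrow> nat set" where
  "jump A = {e. \<exists>y. computes A e e y}"

text \<open>Indices of 2-c.e. sets are Cantor codes of pairs of c.e. indices.\<close>

definition X2 :: "nat \<Rightarrow> nat set" where
  "X2 e = (case prod_decode e of (i, j) \<Rightarrow> W i - W j)"

definition X2_stage :: "nat \<Rightarrow> nat \<Rightarrow> nat set" where
  "X2_stage e s = (case prod_decode e of (i, j) \<Rightarrow> W_stage i s - W_stage j s)"

text \<open>
  A computable enumeration is a strong array: the stages are finite and given by canonical indices,
  where \<^const>\<open>set_encode\<close> sends a finite set \<open>D\<close> to the sum of the \<open>2 ^ x\<close> for \<open>x \<in> D\<close>.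
\<close>

definition computable_enumeration :: "(nat \<Rightarrow> nat set) \<Rightarrow> nat set \<Rightarrow> bool" where
  "computable_enumeration As A \<longleftrightarrow>
     (\<forall>s. finite (As s)) \<and> mono As \<and> (\<Union>s. As s) = A \<and>
     computable_fun (\<lambda>s. set_encode (As s))"

text \<open>
  The notion does not depend on the chosen computable enumeration of \<open>A\<close>: if \<open>Bs\<close> is another one,
  apply the condition for \<open>As\<close> to \<open>h \<circ> p\<close>, where \<open>h s\<close> is the least \<open>t\<close> with \<open>Bs s \<subseteq> As t\<close>.
\<close>

definition two_tardy :: "nat set \<Rightarrow> bool" where
  "two_tardy A \<longleftrightarrow> (\<exists>As. computable_enumeration As A \<and>
     (\<forall>p. mono p \<and> computable_fun p \<longrightarrow>
       (\<exists>e. X2 e = - A \<and> (\<forall>x s. x \<in> X2_stage e s \<longrightarrow> x \<notin> As (p s)))))"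

end

theory Submission
  imports Defs
begin

text \<open>
  \<open>A\<close> is built by an infinite injury construction on the binary tree. A node at level \<open>n\<close> guesses
  whether \<open>\<Phi>\<^sub>n(A)\<close> is total (left child) or not (right child); one kind of guess serves both the
  tardiness and the lowness requirements, because every computable function has an index whose
  program asks no oracle questions. Each node at level \<open>e\<close> also wants to put a number \<open>x \<in> W\<^sub>e\<close> into
  \<open>A\<close>, chosen larger than the uses of the first \<open>e\<close> values of all functions guessed total above it.
  Such an \<open>x\<close> does not enter \<open>A\<close> at once. It carries a token that climbs to the root one node at a
  time, each step at a visit of the node it currently occupies, and is cancelled when a node to the
  left is visited. When the token reaches the left child of a node for \<open>\<Phi>\<^sub>n = p\<close>, the number is
  withdrawn from the 2-c.e. approximation of the complement of \<open>A\<close>, and the next visit of that child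
  takes place only after \<open>p\<close> has converged at the stage of the withdrawal. This is what
  2-tardiness asks for.

  Along the true path \<open>f\<close> tokens are never stuck, so \<open>A\<close> is simple, and a computation restrained by
  a node on \<open>f\<close> is destroyed only finitely often. Hence \<open>\<Phi>\<^sub>n(A)\<close> is total iff \<open>f\<close> turns left at
  level \<open>n\<close>, and as \<open>f\<close> is computable in \<open>\<emptyset>''\<close>, so is \<open>A''\<close>. The recursion theorem is avoided:
  the delays with which the enumerations \<open>W\<^bsub>j,s\<^esub>\<close> lag behind the construction are bounded by one
  computable function \<open>h\<close>, and the construction is consulted at an index of \<open>p \<circ> h\<close>.
\<close>

subsection \<open>Relative computability\<close>

abbreviation p1 :: "nat \<Rightarrow> nat" where "p1 x \<equiv> fst (prod_decode x)"
abbreviation p2 :: "nat \<Rightarrow> nat" where "p2 x \<equiv> snd (prod_decode x)"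
abbreviation pr :: "nat \<Rightarrow> nat \<Rightarrow> nat" where "pr x y \<equiv> prod_encode (x, y)"

definition evals :: "nat set \<Rightarrow> prog \<Rightarrow> nat \<Rightarrow> nat \<Rightarrow> bool" where
  "evals B c x y \<longleftrightarrow> (\<exists>s. run B s c x = Some y)"

lemma evals_unique: "evals B c x y \<Longrightarrow> evals B c x z \<Longrightarrow> y = z"
  unfolding evals_def by (metis linorder_le_cases option.inject run_mono)

lemma evals_basic:
  "evals B Zero x 0" "evals B Succ x (Suc x)" "evals B Fst x (p1 x)" "evals B Snd x (p2 x)"
  "evals B Query x (if x \<in> B then 1 else 0)"
  unfolding evals_def by (rule exI[of _ "Suc 0"], simp)+

lemma evals_common:
  assumes "evals B c x u" "evals B d y v"
  obtains s where "run B s c x = Some u" "run B s d y = Some v"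
  using assms unfolding evals_def by (metis linorder_le_cases run_mono)

lemma evals_Pair: "evals B f x u \<Longrightarrow> evals B g x v \<Longrightarrow> evals B (Pair f g) x (pr u v)"
proof -
  assume "evals B f x u" "evals B g x v"
  then obtain s where "run B s f x = Some u" "run B s g x = Some v" by (rule evals_common)
  then have "run B (Suc s) (Pair f g) x = Some (pr u v)" by simp
  then show ?thesis unfolding evals_def by blast
qed

lemma evals_Comp: "evals B g x u \<Longrightarrow> evals B f u v \<Longrightarrow> evals B (Comp f g) x v"
proof -
  assume "evals B g x u" "evals B f u v"
  then obtain s where "run B s g x = Some u" "run B s f u = Some v" by (rule evals_common)
  then have "run B (Suc s) (Comp f g) x = Some v" by simp
  then show ?thesis unfolding evals_def by blast
qed

lemma evals_Prec_0: "evals B f a y \<Longrightarrow> evals B (Prec f g) (pr a 0) y"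
proof -
  assume "evals B f a y"
  then obtain s where "run B s f a = Some y" unfolding evals_def by blast
  then have "run B (Suc s) (Prec f g) (pr a 0) = Some y" by simp
  then show ?thesis unfolding evals_def by blast
qed

lemma evals_Prec_Suc:
  "evals B (Prec f g) (pr a n) r \<Longrightarrow> evals B g (pr a (pr n r)) y \<Longrightarrow>
    evals B (Prec f g) (pr a (Suc n)) y"
proof -
  assume "evals B (Prec f g) (pr a n) r" "evals B g (pr a (pr n r)) y"
  then obtain s where "run B s (Prec f g) (pr a n) = Some r" "run B s g (pr a (pr n r)) = Some y"
    by (rule evals_common)
  then have "run B (Suc s) (Prec f g) (pr a (Suc n)) = Some y" by simp
  then show ?thesis unfolding evals_def by blast
qed

lemma evals_Mu_0: "evals B f (pr a m) 0 \<Longrightarrow> evals B (Mu f) (pr a m) m"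
proof -
  assume "evals B f (pr a m) 0"
  then obtain s where "run B s f (pr a m) = Some 0" unfolding evals_def by blast
  then have "run B (Suc s) (Mu f) (pr a m) = Some m" by simp
  then show ?thesis unfolding evals_def by blast
qed

lemma evals_Mu_Suc:
  "evals B f (pr a m) (Suc k) \<Longrightarrow> evals B (Mu f) (pr a (Suc m)) y \<Longrightarrow> evals B (Mu f) (pr a m) y"
proof -
  assume "evals B f (pr a m) (Suc k)" "evals B (Mu f) (pr a (Suc m)) y"
  then obtain s where "run B s f (pr a m) = Some (Suc k)" "run B s (Mu f) (pr a (Suc m)) = Some y"
    by (rule evals_common)
  then have "run B (Suc s) (Mu f) (pr a m) = Some y" by simp
  then show ?thesis unfolding evals_def by blast
qed

lemma prog_code_program [simp]: "prog_code (program e) = e"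
  unfolding program_def by (rule surj_f_inv_f[OF surj_prog_code])

lemma program_prog_code [simp]: "program (prog_code c) = c"
  unfolding program_def by (rule inv_f_f[OF inj_prog_code])

lemma computes_iff_evals: "computes B e x y \<longleftrightarrow> evals B (program e) x y"
  unfolding computes_def evals_def ..

section \<open>Closure properties of functions and predicates computable in an oracle\<close>

definition rec_in :: "nat set \<Rightarrow> (nat \<Rightarrow> nat) \<Rightarrow> bool" where
  "rec_in B f \<longleftrightarrow> (\<exists>c. \<forall>x. evals B c x (f x))"

text \<open>Predicates are treated through characteristic functions. The rules collected in
  \<open>rec_intros\<close> follow the syntax of a term, so that the computability of an explicitly
  written function is checked by \<open>intro\<close>; this is why the definitions of the
  construction use bounded quantifiers.\<close>

definition dec_in :: "nat set \<Rightarrow> (nat \<Rightarrow> bool) \<Rightarrow> bool" where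
  "dec_in B P \<longleftrightarrow> rec_in B (\<lambda>x. if P x then 1 else 0)"

lemma computable_fun_iff_rec_in: "computable_fun f \<longleftrightarrow> rec_in {} f"
  unfolding computable_fun_def rec_in_def computes_iff_evals
  by (metis program_prog_code)

lemma turing_le_iff_dec_in: "turing_le A B \<longleftrightarrow> dec_in B (\<lambda>x. x \<in> A)"
  unfolding turing_le_def dec_in_def rec_in_def computes_iff_evals
  by (metis program_prog_code)

named_theorems rec_intros

lemma rec_id [rec_intros]: "rec_in B (\<lambda>x. x)"
  unfolding rec_in_def using evals_Pair[OF evals_basic(3,4)] by (metis prod.collapse prod_decode_inverse)

lemma rec_const [rec_intros]: "rec_in B (\<lambda>x. k)"
proof (induction k)
  case 0 show ?case unfolding rec_in_def using evals_basic(1) by blast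
next
  case (Suc k) then show ?case unfolding rec_in_def using evals_basic(2) evals_Comp by meson
qed

lemma rec_comp: "rec_in B f \<Longrightarrow> rec_in B g \<Longrightarrow> rec_in B (\<lambda>x. f (g x))"
  unfolding rec_in_def using evals_Comp by meson

lemma dec_comp: "dec_in B P \<Longrightarrow> rec_in B g \<Longrightarrow> dec_in B (\<lambda>x. P (g x))"
  unfolding dec_in_def using rec_comp .

lemma rec_Suc [rec_intros]: "rec_in B f \<Longrightarrow> rec_in B (\<lambda>x. Suc (f x))"
  unfolding rec_in_def using evals_basic(2) evals_Comp by meson

lemma rec_p1 [rec_intros]: "rec_in B f \<Longrightarrow> rec_in B (\<lambda>x. p1 (f x))"
  unfolding rec_in_def using evals_basic(3) evals_Comp by meson

lemma rec_p2 [rec_intros]: "rec_in B f \<Longrightarrow> rec_in B (\<lambda>x. p2 (f x))"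
  unfolding rec_in_def using evals_basic(4) evals_Comp by meson

lemma rec_pr [rec_intros]: "rec_in B f \<Longrightarrow> rec_in B g \<Longrightarrow> rec_in B (\<lambda>x. pr (f x) (g x))"
  unfolding rec_in_def using evals_Pair by meson

lemma dec_oracle: "rec_in B f \<Longrightarrow> dec_in B (\<lambda>x. f x \<in> B)"
  unfolding dec_in_def rec_in_def using evals_basic(5) evals_Comp by meson

text \<open>Currying: computability of a binary \<open>F\<close> is expressed by its action on coded
  pairs, and this rule then substitutes computable arguments.\<close>

lemma rec_comp2:
  "rec_in B (\<lambda>z. F (p1 z) (p2 z)) \<Longrightarrow> rec_in B f \<Longrightarrow> rec_in B g \<Longrightarrow> rec_in B (\<lambda>x. F (f x) (g x))"
  using rec_comp[of B "\<lambda>z. F (p1 z) (p2 z)" "\<lambda>x. pr (f x) (g x)"] rec_pr[of B f g] by simp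

lemma dec_comp2:
  "dec_in B (\<lambda>z. F (p1 z) (p2 z)) \<Longrightarrow> rec_in B f \<Longrightarrow> rec_in B g \<Longrightarrow> dec_in B (\<lambda>x. F (f x) (g x))"
  using dec_comp[of B "\<lambda>z. F (p1 z) (p2 z)" "\<lambda>x. pr (f x) (g x)"] rec_pr[of B f g] by simp

text \<open>The parameter of \<open>Prec\<close> is the whole input \<open>x\<close>; base, step and
  length of the recursion can all be recomputed from it.\<close>

lemma rec_rec_nat [rec_intros]:
  assumes a: "rec_in B a" and g: "rec_in B (\<lambda>z. g (p1 z) (p1 (p2 z)) (p2 (p2 z)))"
    and n: "rec_in B n"
  shows "rec_in B (\<lambda>x. rec_nat (a x) (g x) (n x))"
proof -
  obtain ca cg where ca: "\<And>x. evals B ca x (a x)"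
    and cg: "\<And>z. evals B cg z (g (p1 z) (p1 (p2 z)) (p2 (p2 z)))"
    using a g unfolding rec_in_def by blast
  have "evals B (Prec ca cg) (pr x k) (rec_nat (a x) (g x) k)" for x k
  proof (induction k)
    case 0 then show ?case using evals_Prec_0[OF ca] by simp
  next
    case (Suc k)
    show ?case using evals_Prec_Suc[OF Suc cg[of "pr x (pr k _)"]] by simp
  qed
  then have "rec_in B (\<lambda>z. rec_nat (a (p1 z)) (g (p1 z)) (p2 z))"
    unfolding rec_in_def by (metis prod.collapse prod_decode_inverse)
  from rec_comp2[OF this rec_id n] show ?thesis .
qed

lemma rec_If [rec_intros]:
  assumes "dec_in B P" "rec_in B f" "rec_in B g"
  shows "rec_in B (\<lambda>x. if P x then f x else g x)"
proof -
  \<comment> \<open>A case distinction is a primitive recursion of length 1 or 0.\<close>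
  have "rec_in B (\<lambda>x. rec_nat (g x) (\<lambda>_ _. f x) (if P x then 1 else 0))"
    using assms(1) unfolding dec_in_def
    by (intro rec_rec_nat assms rec_comp[OF assms(2)] rec_intros)
  moreover have "rec_nat (g x) (\<lambda>_ _. f x) (if P x then 1 else 0) = (if P x then f x else g x)" for x
    by simp
  ultimately show ?thesis by simp
qed

lemma dec_const [rec_intros]: "dec_in B (\<lambda>x. P)"
  unfolding dec_in_def by (rule rec_const)

lemma dec_not [rec_intros]: "dec_in B P \<Longrightarrow> dec_in B (\<lambda>x. \<not> P x)"
proof -
  assume "dec_in B P"
  then have "rec_in B (\<lambda>x. if P x then 0 else 1)" using rec_If rec_const by meson
  moreover have "(\<lambda>x. if P x then 0 else 1 :: nat) = (\<lambda>x. if \<not> P x then 1 else 0)" by auto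
  ultimately show ?thesis unfolding dec_in_def by simp
qed

lemma dec_conj [rec_intros]: "dec_in B P \<Longrightarrow> dec_in B Q \<Longrightarrow> dec_in B (\<lambda>x. P x \<and> Q x)"
proof -
  assume "dec_in B P" "dec_in B Q"
  then have "rec_in B (\<lambda>x. if P x then (if Q x then 1 else 0) else 0)"
    using rec_If rec_const by meson
  moreover have "(\<lambda>x. if P x then (if Q x then 1 else 0) else 0 :: nat) = (\<lambda>x. if P x \<and> Q x then 1 else 0)"
    by auto
  ultimately show ?thesis unfolding dec_in_def by simp
qed

lemma dec_disj [rec_intros]: "dec_in B P \<Longrightarrow> dec_in B Q \<Longrightarrow> dec_in B (\<lambda>x. P x \<or> Q x)"
  using dec_not[OF dec_conj[OF dec_not dec_not], of B P Q] by simp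

lemma dec_imp [rec_intros]: "dec_in B P \<Longrightarrow> dec_in B Q \<Longrightarrow> dec_in B (\<lambda>x. P x \<longrightarrow> Q x)"
  unfolding imp_conv_disj by (rule dec_disj[OF dec_not])

lemma rec_pred [rec_intros]: "rec_in B f \<Longrightarrow> rec_in B (\<lambda>x. f x - Suc 0)"
proof -
  assume f: "rec_in B f"
  have "rec_in B (\<lambda>x. rec_nat 0 (\<lambda>k _. k) (f x))"
    by (intro rec_intros f)
  moreover have "rec_nat 0 (\<lambda>k _. k) n = n - Suc 0" for n by (cases n) simp_all
  ultimately show ?thesis by simp
qed

lemma rec_add [rec_intros]:
  assumes "rec_in B f" "rec_in B g" shows "rec_in B (\<lambda>x. f x + g x)"
proof -
  have "rec_in B (\<lambda>x. rec_nat (f x) (\<lambda>_ r. Suc r) (g x))"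
    by (intro rec_intros assms)
  moreover have "rec_nat a (\<lambda>_ r. Suc r) n = a + n" for a n by (induction n) simp_all
  ultimately show ?thesis by simp
qed

lemma rec_diff [rec_intros]:
  assumes "rec_in B f" "rec_in B g" shows "rec_in B (\<lambda>x. f x - g x)"
proof -
  have "rec_in B (\<lambda>x. rec_nat (f x) (\<lambda>_ r. r - Suc 0) (g x))"
    by (intro rec_intros assms)
  moreover have "rec_nat a (\<lambda>_ r. r - Suc 0) n = a - n" for a n :: nat by (induction n) simp_all
  ultimately show ?thesis by simp
qed

lemma rec_mult [rec_intros]:
  assumes "rec_in B f" "rec_in B g" shows "rec_in B (\<lambda>x. f x * g x)"
proof -
  have "rec_in B (\<lambda>x. rec_nat 0 (\<lambda>_ r. r + f x) (g x))"
    by (intro rec_intros assms rec_comp[OF assms(1)])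
  moreover have "rec_nat 0 (\<lambda>_ r. r + a) n = a * n" for a n :: nat by (induction n) simp_all
  ultimately show ?thesis by simp
qed

lemma rec_power [rec_intros]:
  assumes "rec_in B f" "rec_in B g" shows "rec_in B (\<lambda>x. f x ^ g x)"
proof -
  have "rec_in B (\<lambda>x. rec_nat 1 (\<lambda>_ r. f x * r) (g x))"
    by (intro rec_intros assms rec_comp[OF assms(1)])
  moreover have "rec_nat 1 (\<lambda>_ r. a * r) n = a ^ n" for a n :: nat by (induction n) simp_all
  ultimately show ?thesis by simp
qed

lemma dec_eq_0: assumes "rec_in B f" shows "dec_in B (\<lambda>x. f x = 0)"
proof -
  have "rec_in B (\<lambda>x. 1 - f x)" by (intro rec_intros assms)
  moreover have "(\<lambda>x. 1 - f x) = (\<lambda>x. if f x = 0 then 1 else 0)" by auto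
  ultimately show ?thesis unfolding dec_in_def by simp
qed

lemma dec_le [rec_intros]:
  assumes "rec_in B f" "rec_in B g" shows "dec_in B (\<lambda>x. f x \<le> g x)"
  using dec_eq_0[OF rec_diff[OF assms]] by simp

lemma dec_less [rec_intros]:
  assumes "rec_in B f" "rec_in B g" shows "dec_in B (\<lambda>x. f x < g x)"
  using dec_le[OF rec_Suc[OF assms(1)] assms(2)] by (simp add: Suc_le_eq)

lemma dec_eq [rec_intros]:
  assumes "rec_in B f" "rec_in B g" shows "dec_in B (\<lambda>x. f x = g x)"
  using dec_conj[OF dec_le[OF assms] dec_le[OF assms(2,1)]] by (simp add: eq_iff)

lemma dec_ex_less [rec_intros]:
  assumes P: "dec_in B (\<lambda>z. P (p1 z) (p2 z))" and b: "rec_in B b"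
  shows "dec_in B (\<lambda>x. \<exists>y<b x. P x y)"
proof -
  have "dec_in B (\<lambda>z. P (p1 z) (p1 (p2 z)))"
    by (rule dec_comp2[OF P]) (intro rec_intros)+
  then have "rec_in B (\<lambda>x. rec_nat 0 (\<lambda>k r. if P x k then 1 else r) (b x))"
    by (intro rec_intros b)
  moreover have "rec_nat 0 (\<lambda>k r. if P x k then 1 else r) n = (if \<exists>y<n. P x y then 1 else 0 :: nat)" for x n
    by (induction n) (auto simp: less_Suc_eq)
  ultimately show ?thesis unfolding dec_in_def by simp
qed

lemma dec_all_less [rec_intros]:
  assumes P: "dec_in B (\<lambda>z. P (p1 z) (p2 z))" and b: "rec_in B b"
  shows "dec_in B (\<lambda>x. \<forall>y<b x. P x y)"
  using dec_not[OF dec_ex_less[OF dec_not[OF P] b]] by simp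

lemma dec_ex_le [rec_intros]:
  assumes P: "dec_in B (\<lambda>z. P (p1 z) (p2 z))" and b: "rec_in B b"
  shows "dec_in B (\<lambda>x. \<exists>y\<le>b x. P x y)"
  using dec_ex_less[OF P rec_Suc[OF b]] by (simp add: less_Suc_eq_le)

lemma dec_all_le [rec_intros]:
  assumes P: "dec_in B (\<lambda>z. P (p1 z) (p2 z))" and b: "rec_in B b"
  shows "dec_in B (\<lambda>x. \<forall>y\<le>b x. P x y)"
  using dec_all_less[OF P rec_Suc[OF b]] by (simp add: less_Suc_eq_le)

section \<open>Unbounded search\<close>

lemma evals_Mu_search:
  assumes "\<And>m. evals B c (pr x m) (if P m then 0 else 1)" and "P k" "n \<le> k"
  shows "\<exists>y. P y \<and> n \<le> y \<and> (\<forall>i. n \<le> i \<and> i < y \<longrightarrow> \<not> P i) \<and> evals B (Mu c) (pr x n) y"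
  using assms(3)
proof (induction n rule: inc_induct)
  case base
  then show ?case using evals_Mu_0 assms(1)[of k] assms(2) by auto
next
  case (step n)
  show ?case
  proof (cases "P n")
    case True then show ?thesis using evals_Mu_0 assms(1)[of n] by auto
  next
    case False
    from step obtain y where y: "P y" "Suc n \<le> y" "\<forall>i. Suc n \<le> i \<and> i < y \<longrightarrow> \<not> P i"
      "evals B (Mu c) (pr x (Suc n)) y" by blast
    have "evals B (Mu c) (pr x n) y"
      using evals_Mu_Suc[of B c x n 0] assms(1)[of n] False y(4) by simp
    then show ?thesis using y False by (metis Suc_leD not_less_eq_eq le_antisym)
  qed
qed

lemma evals_Mu_cases:
  assumes "evals B (Mu c) (pr x n) y"
  shows "\<exists>m\<ge>n. evals B c (pr x m) 0"
proof -
  have "run B s (Mu c) (pr x n) = Some y \<Longrightarrow> \<exists>m\<ge>n. evals B c (pr x m) 0" for s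
  proof (induction s arbitrary: n)
    case (Suc s)
    then show ?case
      unfolding evals_def
      by (auto split: option.splits nat.splits) (meson Suc_leD)
  qed simp
  then show ?thesis using assms unfolding evals_def by blast
qed

lemma rec_Least:
  assumes P: "dec_in B (\<lambda>z. P (p1 z) (p2 z))" and ex: "\<And>x. \<exists>y. P x y"
  shows "rec_in B (\<lambda>x. LEAST y. P x y)"
proof -
  have "rec_in B (\<lambda>z. if P (p1 z) (p2 z) then 0 else 1)"
    by (intro rec_intros P)
  then obtain c where c: "\<And>z. evals B c z (if P (p1 z) (p2 z) then 0 else 1)"
    unfolding rec_in_def by blast
  \<comment> \<open>\<open>Pair Fst Snd\<close> is the identity, so the inner program turns
    \<open>x\<close> into \<open>pr x 0\<close> and the search starts at 0.\<close>
  have "evals B (Comp (Mu c) (Pair (Pair Fst Snd) Zero)) x (LEAST y. P x y)" for x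
  proof -
    obtain k where k: "P x k" using ex by blast
    obtain y where y: "P x y" "\<forall>i. i < y \<longrightarrow> \<not> P x i" "evals B (Mu c) (pr x 0) y"
      using evals_Mu_search[of B c x "P x" k 0] c[of "pr x _"] k by auto
    have "(LEAST y. P x y) = y"
      using y(1,2) by (intro Least_equality) (auto simp: not_less[symmetric])
    moreover have "evals B (Pair (Pair Fst Snd) Zero) x (pr x 0)"
      using evals_Pair[OF evals_Pair[OF evals_basic(3,4)] evals_basic(1), of B x] by simp
    ultimately show ?thesis using y(3) evals_Comp by simp
  qed
  then show ?thesis unfolding rec_in_def by blast
qed

lemma rec_div [rec_intros]:
  assumes "rec_in B f" "rec_in B g" shows "rec_in B (\<lambda>x. f x div g x)"
proof -
  \<comment> \<open>The disjunct \<open>g x = 0\<close> makes the search succeed at once with value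
    0, which is the value of division by 0 in HOL.\<close>
  have ex: "\<exists>q. g x = 0 \<or> f x < Suc q * g x" for x
    by (cases "g x") (auto intro: exI[of _ "f x"])
  have "rec_in B (\<lambda>x. LEAST q. g x = 0 \<or> f x < Suc q * g x)"
    by (rule rec_Least[OF _ ex])
      (intro rec_intros rec_comp[OF assms(1)] rec_comp[OF assms(2)])
  moreover have "(LEAST q. g x = 0 \<or> f x < Suc q * g x) = f x div g x" for x
  proof (rule Least_equality)
    show "g x = 0 \<or> f x < Suc (f x div g x) * g x"
      by (metis add.commute dividend_less_div_times mult.commute mult_Suc not_gr_zero)
    fix q assume "g x = 0 \<or> f x < Suc q * g x"
    then show "f x div g x \<le> q"
      by (metis div_by_0 le0 less_Suc_eq_le less_mult_imp_div_less)
  qed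
  ultimately show ?thesis by simp
qed

lemma rec_mod [rec_intros]:
  assumes "rec_in B f" "rec_in B g" shows "rec_in B (\<lambda>x. f x mod g x)"
  using rec_diff[OF assms(1) rec_mult[OF rec_div[OF assms] assms(2)]]
  by (simp add: minus_div_mult_eq_mod)

text \<open>Membership in a canonically coded finite set is a binary digit of its code.\<close>

lemma dec_set_decode [rec_intros]:
  assumes "rec_in B f" "rec_in B g" shows "dec_in B (\<lambda>x. f x \<in> set_decode (g x))"
proof -
  have "dec_in B (\<lambda>x. g x div 2 ^ f x mod 2 = 1)" by (intro rec_intros assms)
  then show ?thesis unfolding set_decode_def by (simp add: odd_iff_mod_2_eq_one)
qed

section \<open>Change of oracle and the s-m-n theorem\<close>

primrec subst_query :: "prog \<Rightarrow> prog \<Rightarrow> prog" where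
  "subst_query q Zero = Zero"
| "subst_query q Succ = Succ"
| "subst_query q Fst = Fst"
| "subst_query q Snd = Snd"
| "subst_query q Query = q"
| "subst_query q (Pair f g) = Pair (subst_query q f) (subst_query q g)"
| "subst_query q (Comp f g) = Comp (subst_query q f) (subst_query q g)"
| "subst_query q (Prec f g) = Prec (subst_query q f) (subst_query q g)"
| "subst_query q (Mu f) = Mu (subst_query q f)"

text \<open>Queries to \<open>B\<close> are answered by the program \<open>q\<close> instead. The
  induction runs over the depth, because \<open>Prec\<close> and \<open>Mu\<close> call
  themselves.\<close>

lemma evals_subst_query:
  assumes q: "\<And>x. evals C q x (if x \<in> B then 1 else 0)"
  shows "evals B c x y \<Longrightarrow> evals C (subst_query q c) x y"
proof -
  have "run B s c x = Some y \<Longrightarrow> evals C (subst_query q c) x y" for s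
  proof (induction s arbitrary: c x y)
    case (Suc s)
    obtain a k where x: "x = pr a k" by (metis prod.exhaust prod_decode_inverse)
    show ?case
    proof (cases c)
      case Zero then show ?thesis using Suc.prems evals_basic by auto
    next
      case Succ then show ?thesis using Suc.prems evals_basic by auto
    next
      case Fst then show ?thesis using Suc.prems evals_basic(3)[of C x] by auto
    next
      case Snd then show ?thesis using Suc.prems evals_basic(4)[of C x] by auto
    next
      case Query then show ?thesis using Suc.prems q[of x] by auto
    next
      case (Pair f g)
      then show ?thesis using Suc.prems by (auto split: option.splits intro!: evals_Pair Suc.IH)
    next
      case (Comp f g)
      then show ?thesis using Suc.prems by (auto split: option.splits intro: evals_Comp Suc.IH)
    next
      case (Prec f g)
      show ?thesis
      proof (cases k)
        case 0
        then show ?thesis using Suc.prems Prec x by (auto intro!: evals_Prec_0 Suc.IH)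
      next
        case (Suc k')
        then obtain r where r: "run B s c (pr a k') = Some r" "run B s g (pr a (pr k' r)) = Some y"
          using Suc.prems Prec x by (auto split: option.splits)
        show ?thesis
          using evals_Prec_Suc Suc.IH[OF r(1)] Suc.IH[OF r(2)] Prec x \<open>k = Suc k'\<close> by auto
      qed
    next
      case (Mu f)
      obtain v where v: "run B s f x = Some v" using Suc.prems Mu x by (auto split: option.splits)
      show ?thesis
      proof (cases v)
        case 0
        then show ?thesis using Suc.prems Mu x v Suc.IH[OF v] evals_Mu_0 by auto
      next
        case (Suc v')
        then have "run B s c (pr a (Suc k)) = Some y" using Suc.prems Mu x v by auto
        then show ?thesis using Suc.IH[OF v] Suc.IH x Mu \<open>v = Suc v'\<close> evals_Mu_Suc by fastforce
      qed
    qed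
  qed simp
  then show "evals B c x y \<Longrightarrow> evals C (subst_query q c) x y" unfolding evals_def by blast
qed

lemma rec_in_turing_le:
  assumes "turing_le B C" "rec_in B f" shows "rec_in C f"
proof -
  obtain q where q: "\<And>x. evals C q x (if x \<in> B then 1 else 0)"
    using assms(1) unfolding turing_le_iff_dec_in dec_in_def rec_in_def by blast
  show ?thesis using assms(2) evals_subst_query[OF q] unfolding rec_in_def by blast
qed

lemma dec_in_turing_le: "turing_le B C \<Longrightarrow> dec_in B P \<Longrightarrow> dec_in C P"
  unfolding dec_in_def using rec_in_turing_le .

lemma turing_le_empty: "turing_le {} B"
  unfolding turing_le_iff_dec_in by (simp add: dec_const)

lemma rec_in_empty: "rec_in {} f \<Longrightarrow> rec_in B f"
  using rec_in_turing_le[OF turing_le_empty] .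

text \<open>Answering every query by \<open>Zero\<close> yields a program that behaves under any
  oracle as under the empty set. This supplies the level of the tree at which a given computable
  function is handled.\<close>

lemma oracle_free_index:
  assumes "rec_in {} f"
  obtains n where "\<And>B x. computes B n x (f x)"
proof -
  obtain c where c: "\<And>x. evals {} c x (f x)" using assms unfolding rec_in_def by blast
  have "evals B (subst_query Zero c) x (f x)" for B x
    using evals_subst_query[of B Zero "{}" c x "f x"] evals_basic(1) c by simp
  then show ?thesis using that[of "prog_code (subst_query Zero c)"] unfolding computes_iff_evals by simp
qed

primrec const_prog :: "nat \<Rightarrow> prog" where
  "const_prog 0 = Zero"
| "const_prog (Suc k) = Comp Succ (const_prog k)"

lemma evals_const_prog: "evals B (const_prog k) x k"
  by (induction k) (auto intro: evals_basic evals_Comp)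

text \<open>\<^term>\<open>Pair Fst Snd\<close> is the identity.\<close>

definition smn :: "prog \<Rightarrow> nat \<Rightarrow> nat" where
  "smn c k = prog_code (Comp c (Pair (const_prog k) (Pair Fst Snd)))"

lemma rec_smn [rec_intros]: assumes "rec_in B f" shows "rec_in B (\<lambda>x. smn c (f x))"
proof -
  \<comment> \<open>The constants 6 and 4 come from \<open>prog_code\<close> of \<open>Comp\<close>,
    and 1 is the code of \<open>Succ\<close>.\<close>
  have "rec_in B (\<lambda>x. rec_nat 0 (\<lambda>_ r. 6 + 4 * pr 1 r) (f x))"
    by (intro rec_intros assms)
  moreover have "rec_nat 0 (\<lambda>_ r. 6 + 4 * pr 1 r) k = prog_code (const_prog k)" for k
    by (induction k) simp_all
  ultimately have "rec_in B (\<lambda>x. prog_code (const_prog (f x)))" by simp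
  then show ?thesis unfolding smn_def prog_code.simps by (intro rec_intros)
qed

lemma program_smn: "program (smn c k) = Comp c (Pair (const_prog k) (Pair Fst Snd))"
  unfolding smn_def by (rule program_prog_code)

lemma computes_smn_iff: "computes B (smn c k) x y \<longleftrightarrow> evals B c (pr k x) y"
proof -
  have arg: "evals B (Pair (const_prog k) (Pair Fst Snd)) x (pr k x)"
    using evals_Pair[OF evals_const_prog evals_Pair[OF evals_basic(3,4)], of B k x] by simp
  have "evals B c (pr k x) y" if "evals B (Comp c (Pair (const_prog k) (Pair Fst Snd))) x y"
  proof -
    from that obtain s where "run B s (Comp c (Pair (const_prog k) (Pair Fst Snd))) x = Some y"
      unfolding evals_def by blast
    then obtain t u where t: "run B t (Pair (const_prog k) (Pair Fst Snd)) x = Some u"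
      "run B t c u = Some y"
      by (cases s) (auto split: option.splits)
    then have "u = pr k x" using arg evals_unique unfolding evals_def by blast
    then show ?thesis using t unfolding evals_def by blast
  qed
  then show ?thesis using evals_Comp[OF arg] unfolding computes_iff_evals program_smn by blast
qed

subsection \<open>Certificates of computations\<close>

text \<open>
  A halting computation is witnessed by a finite set of quadruples (depth, program, input, output),
  coded by a number \<open>w\<close>, in which each member follows from members of depth one less by a clause
  of \<^const>\<open>run\<close>. Every number occurring in it, oracle queries included, is less than \<open>w\<close>, so the
  bound \<open>u\<close> in \<open>conv\<close> below bounds the running time and the use simultaneously.
\<close>

definition entry :: "nat \<Rightarrow> nat \<Rightarrow> nat \<Rightarrow> nat \<Rightarrow> nat \<Rightarrow> bool" where
  "entry w s c x y \<longleftrightarrow> pr s (pr c (pr x y)) \<in> set_decode w"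

definition justified :: "nat set \<Rightarrow> nat \<Rightarrow> nat \<Rightarrow> nat \<Rightarrow> nat \<Rightarrow> nat \<Rightarrow> bool" where
  "justified B w s c x y \<longleftrightarrow> 0 < s \<and>
    (c = 0 \<and> y = 0 \<or> c = 1 \<and> y = Suc x \<or> c = 2 \<and> y = p1 x \<or> c = 3 \<and> y = p2 x
     \<or> c = 4 \<and> y = (if x \<in> B then 1 else 0)
     \<or> 5 \<le> c \<and> (c - 5) mod 4 = 0 \<and>
         entry w (s - 1) (p1 ((c - 5) div 4)) x (p1 y) \<and> entry w (s - 1) (p2 ((c - 5) div 4)) x (p2 y)
     \<or> 5 \<le> c \<and> (c - 5) mod 4 = 1 \<and>
         (\<exists>u<w. entry w (s - 1) (p2 ((c - 5) div 4)) x u \<and> entry w (s - 1) (p1 ((c - 5) div 4)) u y)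
     \<or> 5 \<le> c \<and> (c - 5) mod 4 = 2 \<and> p2 x = 0 \<and> entry w (s - 1) (p1 ((c - 5) div 4)) (p1 x) y
     \<or> 5 \<le> c \<and> (c - 5) mod 4 = 2 \<and> 0 < p2 x \<and>
         (\<exists>r<w. entry w (s - 1) c (pr (p1 x) (p2 x - 1)) r \<and>
           entry w (s - 1) (p2 ((c - 5) div 4)) (pr (p1 x) (pr (p2 x - 1) r)) y)
     \<or> 5 \<le> c \<and> (c - 5) mod 4 = 3 \<and> y = p2 x \<and> entry w (s - 1) ((c - 5) div 4) x 0
     \<or> 5 \<le> c \<and> (c - 5) mod 4 = 3 \<and>
         (\<exists>k<w. entry w (s - 1) ((c - 5) div 4) x (Suc k) \<and>
           entry w (s - 1) c (pr (p1 x) (Suc (p2 x))) y))"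

definition cert :: "nat set \<Rightarrow> nat \<Rightarrow> bool" where
  "cert B w \<longleftrightarrow> (\<forall>z<w. z \<in> set_decode w \<longrightarrow>
     justified B w (p1 z) (p1 (p2 z)) (p1 (p2 (p2 z))) (p2 (p2 (p2 z))))"

definition conv :: "nat set \<Rightarrow> nat \<Rightarrow> nat \<Rightarrow> nat \<Rightarrow> nat \<Rightarrow> bool" where
  "conv B u e x y \<longleftrightarrow> (\<exists>w<u. cert B w \<and> (\<exists>s<w. entry w s e x y))"

lemma set_decode_less: "z \<in> set_decode w \<Longrightarrow> z < w"
proof -
  assume "z \<in> set_decode w"
  then have "2 ^ z \<le> w"
    using not_less unfolding set_decode_def by fastforce
  then show ?thesis using less_exp[of z] by linarith
qed

lemma entry_less:
  assumes "entry w s c x y"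
  shows "s < w" "c < w" "x < w" "y < w"
proof -
  have "pr s (pr c (pr x y)) < w" using assms set_decode_less unfolding entry_def by blast
  moreover have "s \<le> pr s (pr c (pr x y))" "pr c (pr x y) \<le> pr s (pr c (pr x y))"
    "c \<le> pr c (pr x y)" "pr x y \<le> pr c (pr x y)" "x \<le> pr x y" "y \<le> pr x y"
    by (rule le_prod_encode_1 le_prod_encode_2)+
  ultimately show "s < w" "c < w" "x < w" "y < w" by linarith+
qed

text \<open>\<open>entry\<close> occurs only positively in \<open>justified\<close>; the quantifier
  bounds stay correct because every component of an entry is smaller than the code containing
  it.\<close>

lemma justified_mono:
  assumes j: "justified B w s c x y" and sub: "\<And>s c x y. entry w s c x y \<Longrightarrow> entry w' s c x y"
  shows "justified B w' s c x y"
  using j unfolding justified_def by (elim conjE disjE exE) (auto intro: sub entry_less Suc_lessD[OF entry_less(4)])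

lemma cert_iff:
  "cert B w \<longleftrightarrow> (\<forall>s c x y. entry w s c x y \<longrightarrow> justified B w s c x y)"
proof
  assume c: "cert B w"
  show "\<forall>s c x y. entry w s c x y \<longrightarrow> justified B w s c x y"
  proof (intro allI impI)
    fix s c x y assume e: "entry w s c x y"
    have "pr s (pr c (pr x y)) < w" using e set_decode_less unfolding entry_def by blast
    then show "justified B w s c x y"
      using c[unfolded cert_def, rule_format, of "pr s (pr c (pr x y))"] e unfolding entry_def by simp
  qed
next
  assume a: "\<forall>s c x y. entry w s c x y \<longrightarrow> justified B w s c x y"
  show "cert B w" unfolding cert_def
  proof (intro allI impI)
    fix z assume "z \<in> set_decode w"
    then have "entry w (p1 z) (p1 (p2 z)) (p1 (p2 (p2 z))) (p2 (p2 (p2 z)))"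
      unfolding entry_def by simp
    then show "justified B w (p1 z) (p1 (p2 z)) (p1 (p2 (p2 z))) (p2 (p2 (p2 z)))" using a by blast
  qed
qed

text \<open>Codes from 5 on are read by the residue of \<open>c - 5\<close> modulo 4, in the order
  \<open>Pair\<close>, \<open>Comp\<close>, \<open>Prec\<close>, \<open>Mu\<close>.\<close>

lemma program_simps:
  "program 0 = Zero" "program 1 = Succ" "program 2 = Fst" "program 3 = Snd" "program 4 = Query"
  "5 \<le> c \<Longrightarrow> (c - 5) mod 4 = 0 \<Longrightarrow>
    program c = Pair (program (p1 ((c - 5) div 4))) (program (p2 ((c - 5) div 4)))"
  "5 \<le> c \<Longrightarrow> (c - 5) mod 4 = 1 \<Longrightarrow>
    program c = Comp (program (p1 ((c - 5) div 4))) (program (p2 ((c - 5) div 4)))"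
  "5 \<le> c \<Longrightarrow> (c - 5) mod 4 = 2 \<Longrightarrow>
    program c = Prec (program (p1 ((c - 5) div 4))) (program (p2 ((c - 5) div 4)))"
  "5 \<le> c \<Longrightarrow> (c - 5) mod 4 = 3 \<Longrightarrow> program c = Mu (program ((c - 5) div 4))"
proof -
  have eq: "prog_code p = e \<Longrightarrow> program e = p" for p e using program_prog_code by blast
  show "program 0 = Zero" "program 1 = Succ" "program 2 = Fst" "program 3 = Snd" "program 4 = Query"
    by (rule eq, simp)+
  assume c: "5 \<le> c"
  have dm: "(c - 5) div 4 * 4 + (c - 5) mod 4 = c - 5" by (rule div_mult_mod_eq)
  show "(c - 5) mod 4 = 0 \<Longrightarrow>
    program c = Pair (program (p1 ((c - 5) div 4))) (program (p2 ((c - 5) div 4)))"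
    by (rule eq) (use c dm in \<open>simp only: prog_code.simps prog_code_program prod.collapse prod_decode_inverse; linarith\<close>)
  show "(c - 5) mod 4 = 1 \<Longrightarrow>
    program c = Comp (program (p1 ((c - 5) div 4))) (program (p2 ((c - 5) div 4)))"
    by (rule eq) (use c dm in \<open>simp only: prog_code.simps prog_code_program prod.collapse prod_decode_inverse; linarith\<close>)
  show "(c - 5) mod 4 = 2 \<Longrightarrow>
    program c = Prec (program (p1 ((c - 5) div 4))) (program (p2 ((c - 5) div 4)))"
    by (rule eq) (use c dm in \<open>simp only: prog_code.simps prog_code_program prod.collapse prod_decode_inverse; linarith\<close>)
  show "(c - 5) mod 4 = 3 \<Longrightarrow> program c = Mu (program ((c - 5) div 4))"
    by (rule eq) (use c dm in \<open>simp only: prog_code.simps prog_code_program prod.collapse prod_decode_inverse; linarith\<close>)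
qed

text \<open>Each member is justified by members of depth one less, so induction on the depth applies
  and circular justifications cannot occur.\<close>

lemma cert_sound:
  assumes "cert B w" "entry w s c x y" shows "run B s (program c) x = Some y"
  using assms(2)
proof (induction s arbitrary: c x y)
  case 0
  then show ?case using assms(1) unfolding cert_iff justified_def by blast
next
  case (Suc s)
  have IH: "entry w s c x y \<Longrightarrow> run B s (program c) x = Some y" for c x y by (rule Suc.IH)
  have "justified B w (Suc s) c x y" using Suc.prems assms(1) unfolding cert_iff by blast
  then show ?case
    unfolding justified_def
    apply (elim conjE disjE exE)
    subgoal by (simp add: program_simps(1))
    subgoal using program_simps(2) by simp
    subgoal by (simp add: program_simps(3))
    subgoal by (simp add: program_simps(4))
    subgoal by (simp add: program_simps(5))
    subgoal by (simp add: program_simps(6) IH)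
    subgoal by (auto simp add: program_simps(7) IH split: option.splits)
    subgoal by (auto simp add: program_simps(8) case_prod_beta IH split: option.splits)
    subgoal for r
    proof -
      assume a: "5 \<le> c" "(c - 5) mod 4 = 2" "0 < p2 x"
        "entry w (Suc s - 1) c (pr (p1 x) (p2 x - 1)) r"
        "entry w (Suc s - 1) (p2 ((c - 5) div 4)) (pr (p1 x) (pr (p2 x - 1) r)) y"
      obtain k where k: "p2 x = Suc k" using a(3) by (cases "p2 x") auto
      have "run B s (Prec (program (p1 ((c - 5) div 4))) (program (p2 ((c - 5) div 4)))) (pr (p1 x) k) = Some r"
        using IH[of c "pr (p1 x) k" r] a k by (simp add: program_simps(8))
      moreover have "run B s (program (p2 ((c - 5) div 4))) (pr (p1 x) (pr k r)) = Some y"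
        using IH[of _ "pr (p1 x) (pr k r)" y] a k by simp
      ultimately show ?thesis using a(1,2) k by (simp add: program_simps(8) case_prod_beta)
    qed
    subgoal by (auto simp add: program_simps(9) case_prod_beta IH split: option.splits)
    subgoal for k
    proof -
      assume a: "5 \<le> c" "(c - 5) mod 4 = 3"
        "entry w (Suc s - 1) ((c - 5) div 4) x (Suc k)"
        "entry w (Suc s - 1) c (pr (p1 x) (Suc (p2 x))) y"
      have "run B s (Mu (program ((c - 5) div 4))) (pr (p1 x) (Suc (p2 x))) = Some y"
        using IH[of c "pr (p1 x) (Suc (p2 x))" y] a by (simp add: program_simps(9))
      moreover have "run B s (program ((c - 5) div 4)) x = Some (Suc k)"
        using IH[of _ x "Suc k"] a by simp
      ultimately show ?thesis using a(1,2) by (simp add: program_simps(9) case_prod_beta)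
    qed
    done
qed

lemma cert_union:
  assumes "cert B v" "cert B w"
  obtains u where "cert B u" "\<And>s c x y. entry u s c x y \<longleftrightarrow> entry v s c x y \<or> entry w s c x y"
proof -
  define u where "u = set_encode (set_decode v \<union> set_decode w)"
  have "entry u s c x y \<longleftrightarrow> entry v s c x y \<or> entry w s c x y" for s c x y
    unfolding entry_def u_def by (simp add: set_encode_inverse finite_set_decode)
  moreover from this have "cert B u"
    using assms justified_mono unfolding cert_iff by meson
  ultimately show ?thesis using that by blast
qed

lemma cert_insert:
  assumes "cert B v" "justified B v s c x y"
  obtains u where "cert B u" "entry u s c x y"
proof -
  define u where "u = set_encode (insert (pr s (pr c (pr x y))) (set_decode v))"
  have u: "entry u s' c' x' y' \<longleftrightarrow> s' = s \<and> c' = c \<and> x' = x \<and> y' = y \<or> entry v s' c' x' y'"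
    for s' c' x' y'
    unfolding entry_def u_def by (auto simp: set_encode_inverse finite_set_decode)
  then have "cert B u"
    using assms justified_mono unfolding cert_iff by metis
  then show ?thesis using that u by blast
qed

text \<open>Certificates of the subcomputations, which share one depth, are merged by union, and the
  new quadruple is then inserted.\<close>

lemma cert_complete:
  "run B s c x = Some y \<Longrightarrow> \<exists>w. cert B w \<and> entry w s (prog_code c) x y"
proof (induction s arbitrary: c x y)
  case (Suc s)
  have c0: "cert B 0" unfolding cert_def by simp
  have one: "\<exists>w. cert B w \<and> entry w (Suc s) (prog_code c) x y"
    if "cert B v" "justified B v (Suc s) (prog_code c) x y" for v
    using that cert_insert by metis
  have two: "\<exists>v. cert B v \<and> entry v s (prog_code d) a b \<and> entry v s (prog_code d') a' b'"
    if "run B s d a = Some b" "run B s d' a' = Some b'" for d a b d' a' b'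
    using Suc.IH[OF that(1)] Suc.IH[OF that(2)] cert_union by metis
  have g: "(5 + k + 4 * n - 5) mod 4 = k" "(5 + k + 4 * n - 5) div 4 = n" if "k < 4" for k n :: nat
    using that by simp_all
  have dm: "(5 + 4 * n - 5) mod 4 = 0" "(5 + 4 * n - 5) div 4 = n"
    "(6 + 4 * n - 5) mod 4 = 1" "(6 + 4 * n - 5) div 4 = n"
    "(7 + 4 * n - 5) mod 4 = 2" "(7 + 4 * n - 5) div 4 = n"
    "(8 + 4 * n - 5) mod 4 = 3" "(8 + 4 * n - 5) div 4 = n" for n :: nat
    using g[of 0 n] g[of 1 n] g[of 2 n] g[of 3 n] by simp_all
  obtain a k where x: "x = pr a k" by (metis prod.exhaust prod_decode_inverse)
  show ?case
  proof (cases c)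
    case Zero then show ?thesis using Suc.prems by (intro one[OF c0]) (auto simp: justified_def)
  next
    case Succ then show ?thesis using Suc.prems by (intro one[OF c0]) (auto simp: justified_def)
  next
    case Fst then show ?thesis using Suc.prems by (intro one[OF c0]) (auto simp: justified_def)
  next
    case Snd then show ?thesis using Suc.prems by (intro one[OF c0]) (auto simp: justified_def)
  next
    case Query then show ?thesis using Suc.prems by (intro one[OF c0]) (auto simp: justified_def)
  next
    case (Pair f g)
    then obtain u v where uv: "run B s f x = Some u" "run B s g x = Some v" "y = pr u v"
      using Suc.prems by (auto split: option.splits)
    obtain w where w: "cert B w" "entry w s (prog_code f) x u" "entry w s (prog_code g) x v"
      using two[OF uv(1,2)] by blast
    have "justified B w (Suc s) (prog_code c) x y"
      unfolding justified_def Pair prog_code.simps dm using w uv(3) by simp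
    then show ?thesis using one w(1) by blast
  next
    case (Comp f g)
    then obtain u where u: "run B s g x = Some u" "run B s f u = Some y"
      using Suc.prems by (auto split: option.splits)
    obtain w where w: "cert B w" "entry w s (prog_code g) x u" "entry w s (prog_code f) u y"
      using two[OF u] by blast
    have "justified B w (Suc s) (prog_code c) x y"
      unfolding justified_def Comp prog_code.simps dm using w(2,3) entry_less(4)[OF w(2)] by auto
    then show ?thesis using one w(1) by blast
  next
    case (Prec f g)
    show ?thesis
    proof (cases k)
      case 0
      then have "run B s f a = Some y" using Suc.prems Prec x by simp
      then obtain w where w: "cert B w" "entry w s (prog_code f) a y" using Suc.IH by blast
      have "justified B w (Suc s) (prog_code c) x y"
        unfolding justified_def Prec prog_code.simps dm using w x 0 by simp
      then show ?thesis using one w(1) by blast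
    next
      case (Suc k')
      then obtain r where r: "run B s c (pr a k') = Some r" "run B s g (pr a (pr k' r)) = Some y"
        using Suc.prems Prec x by (auto split: option.splits)
      obtain w where w: "cert B w" "entry w s (prog_code c) (pr a k') r"
        "entry w s (prog_code g) (pr a (pr k' r)) y" using two[OF r] by blast
      have "justified B w (Suc s) (prog_code c) x y"
        using w(2,3) entry_less(4)[OF w(2)] x Suc
        unfolding justified_def Prec prog_code.simps dm by auto
      then show ?thesis using one w(1) by blast
    qed
  next
    case (Mu f)
    obtain v where v: "run B s f x = Some v" using Suc.prems Mu x by (auto split: option.splits)
    show ?thesis
    proof (cases v)
      case 0
      obtain w where w: "cert B w" "entry w s (prog_code f) x v" using Suc.IH[OF v] by blast
      have "justified B w (Suc s) (prog_code c) x y"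
        using w Suc.prems Mu x v 0 unfolding justified_def Mu prog_code.simps dm by simp
      then show ?thesis using one w(1) by blast
    next
      case (Suc v')
      then have "run B s c (pr a (Suc k)) = Some y" using Suc.prems Mu x v by auto
      from two[OF v this] obtain w where w: "cert B w" "entry w s (prog_code f) x v"
        "entry w s (prog_code c) (pr a (Suc k)) y" by blast
      have "justified B w (Suc s) (prog_code c) x y"
        using w(2,3) entry_less(4)[OF w(2)] x Suc
        unfolding justified_def Mu prog_code.simps dm by auto
      then show ?thesis using one w(1) by blast
    qed
  qed
qed simp

lemma conv_less: assumes "conv B u e x y" shows "x < u" "y < u"
  using assms entry_less unfolding conv_def by (meson less_trans)+

lemma conv_run: "conv B u e x y \<Longrightarrow> run B u (program e) x = Some y"
  unfolding conv_def using cert_sound run_mono by (meson less_imp_le_nat less_trans)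

lemma conv_computes: "conv B u e x y \<Longrightarrow> computes B e x y"
  unfolding computes_def using conv_run by blast

lemma computes_conv: assumes "computes B e x y" obtains u where "conv B u e x y"
proof -
  obtain s where "run B s (program e) x = Some y" using assms unfolding computes_def by blast
  then obtain w where "cert B w" "entry w s e x y"
    using cert_complete[of B s "program e" x y] by auto
  then have "conv B (Suc w) e x y" unfolding conv_def using entry_less(1) by blast
  then show ?thesis using that by blast
qed

lemma conv_mono: "conv B u e x y \<Longrightarrow> u \<le> v \<Longrightarrow> conv B v e x y"
  unfolding conv_def by (meson less_le_trans)

text \<open>The use principle: the inputs of all entries, queries included, are smaller than the
  code of the certificate and hence smaller than \<open>u\<close>.\<close>

lemma conv_local:
  assumes "conv B u e x y" and "\<And>z. z < u \<Longrightarrow> z \<in> B \<longleftrightarrow> z \<in> C"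
  shows "conv C u e x y"
proof -
  obtain w s where w: "w < u" "cert B w" "entry w s e x y" "s < w"
    using assms(1) unfolding conv_def by blast
  have "justified C w s' c' x' y'" if "entry w s' c' x' y'" for s' c' x' y'
  proof -
    have "x' < u" using entry_less(3)[OF that] w(1) by simp
    then have "x' \<in> B \<longleftrightarrow> x' \<in> C" using assms(2) by blast
    moreover have "justified B w s' c' x' y'" using w(2) that unfolding cert_iff by blast
    ultimately show ?thesis unfolding justified_def by simp
  qed
  then have "cert C w" unfolding cert_iff by blast
  then show ?thesis using w unfolding conv_def by blast
qed

lemma dec_entry [rec_intros]:
  "rec_in C w \<Longrightarrow> rec_in C s \<Longrightarrow> rec_in C c \<Longrightarrow> rec_in C x \<Longrightarrow> rec_in C y \<Longrightarrow>
    dec_in C (\<lambda>z. entry (w z) (s z) (c z) (x z) (y z))"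
  unfolding entry_def by (intro rec_intros)

text \<open>The oracle may vary with a parameter: \<open>S\<close> is a uniformly decidable family.
  The selector \<open>v\<close> recovers the parameter under the quantifiers of \<open>cert\<close>
  and \<open>conv\<close>.\<close>

lemma dec_justified:
  assumes S: "dec_in C (\<lambda>q. p2 q \<in> S (p1 q))"
    and "rec_in C v" "rec_in C w" "rec_in C s" "rec_in C c" "rec_in C x" "rec_in C y"
  shows "dec_in C (\<lambda>z. justified (S (v z)) (w z) (s z) (c z) (x z) (y z))"
  unfolding justified_def using assms(2-)
  by (intro rec_intros dec_comp2[OF S] assms(2-) rec_comp[OF assms(2)] rec_comp[OF assms(3)]
      rec_comp[OF assms(4)] rec_comp[OF assms(5)] rec_comp[OF assms(6)] rec_comp[OF assms(7)])

lemma dec_conv [rec_intros]: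
  assumes S: "dec_in C (\<lambda>q. p2 q \<in> S (p1 q))"
    and "rec_in C u" "rec_in C e" "rec_in C x" "rec_in C y"
  shows "dec_in C (\<lambda>z. conv (S z) (u z) (e z) (x z) (y z))"
  unfolding conv_def cert_def
  by (intro rec_intros dec_justified[OF S] assms(2-) rec_comp[OF assms(3)]
      rec_comp[OF assms(4)] rec_comp[OF assms(5)])

subsection \<open>Searching and the jump\<close>

lemma evals_CompD: assumes "evals B (Comp f g) x y" obtains u where "evals B g x u" "evals B f u y"
proof -
  obtain s where "run B s (Comp f g) x = Some y" using assms unfolding evals_def by blast
  then obtain t u where "run B t g x = Some u" "run B t f u = Some y"
    by (cases s) (auto split: option.splits)
  then show ?thesis using that unfolding evals_def by blast
qed

lemma search_prog:
  assumes P: "dec_in B (\<lambda>z. P (p1 z) (p2 z))"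
  obtains c where "\<And>x. (\<exists>y. evals B c x y) \<longleftrightarrow> (\<exists>k. P x k)"
proof -
  have "rec_in B (\<lambda>z. if P (p1 z) (p2 z) then 0 else 1)"
    by (intro rec_intros P)
  then obtain c where c: "\<And>z. evals B c z (if P (p1 z) (p2 z) then 0 else 1)"
    unfolding rec_in_def by blast
  let ?d = "Comp (Mu c) (Pair (Pair Fst Snd) Zero)"
  have arg: "evals B (Pair (Pair Fst Snd) Zero) x (pr x 0)" for x
    using evals_Pair[OF evals_Pair[OF evals_basic(3,4)] evals_basic(1), of B x] by simp
  have "(\<exists>y. evals B ?d x y) \<longleftrightarrow> (\<exists>k. P x k)" for x
  proof
    assume "\<exists>y. evals B ?d x y"
    then obtain y where "evals B (Mu c) (pr x 0) y"
      using evals_CompD arg evals_unique by metis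
    then obtain m where "evals B c (pr x m) 0" using evals_Mu_cases by blast
    then have "(if P x m then 0 else 1 :: nat) = 0" using evals_unique[OF c[of "pr x m"]] by simp
    then have "P x m" by (simp split: if_splits)
    then show "\<exists>k. P x k" ..
  next
    assume "\<exists>k. P x k"
    then obtain k where "P x k" ..
    then obtain y where "evals B (Mu c) (pr x 0) y"
      using evals_Mu_search[of B c x "P x" k 0] c[of "pr x _"] by auto
    then show "\<exists>y. evals B ?d x y" using evals_Comp[OF arg] by blast
  qed
  then show ?thesis using that by blast
qed

text \<open>Search combined with s-m-n: a uniformly decidable matrix gives sets c.e. in
  \<open>B\<close> whose indices \<open>smn c k\<close> are computable from the parameter.\<close>

lemma param_search_index:
  assumes P: "dec_in B (\<lambda>z. P (p1 z) (p1 (p2 z)) (p2 (p2 z)))"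
  obtains c where "\<And>k x. (\<exists>y. computes B (smn c k) x y) \<longleftrightarrow> (\<exists>t. P k x t)"
proof -
  have "dec_in B (\<lambda>z. P (p1 (p1 z)) (p2 (p1 z)) (p2 z))"
    using dec_comp[OF P, of "\<lambda>z. pr (p1 (p1 z)) (pr (p2 (p1 z)) (p2 z))"] by (simp add: rec_intros)
  from search_prog[OF this]
  obtain c where "\<And>z. (\<exists>y. evals B c z y) \<longleftrightarrow> (\<exists>t. P (p1 z) (p2 z) t)" by blast
  then have "(\<exists>y. computes B (smn c k) x y) \<longleftrightarrow> (\<exists>t. P k x t)" for k x
    unfolding computes_smn_iff by simp
  then show ?thesis using that by blast
qed

lemma ce_Collect_ex:
  assumes P: "dec_in {} (\<lambda>z. P (p1 z) (p2 z))"
  shows "ce {x. \<exists>k. P x k}"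
proof -
  obtain c where c: "\<And>x. (\<exists>y. evals {} c x y) \<longleftrightarrow> (\<exists>k. P x k)" using search_prog[OF P] by blast
  have "{x. \<exists>k. P x k} = W (prog_code c)"
    unfolding W_def computes_iff_evals using c by simp
  then show ?thesis unfolding ce_def by blast
qed

lemma dec_in_jump_ex:
  assumes P: "dec_in B (\<lambda>z. P (p1 z) (p2 z))"
  shows "dec_in (jump B) (\<lambda>x. \<exists>y. P x y)"
proof -
  have "dec_in B (\<lambda>z. P (p1 z) (p2 (p2 z)))"
    by (rule dec_comp2[OF P]) (intro rec_intros)+
  \<comment> \<open>The matrix ignores the input \<open>x\<close>, so the program halts on its own
    index exactly if a witness exists.\<close>
  from param_search_index[of B "\<lambda>k x t. P k t", OF this]
  obtain c where c: "\<And>k x. (\<exists>y. computes B (smn c k) x y) \<longleftrightarrow> (\<exists>t. P k t)" by blast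
  have "dec_in (jump B) (\<lambda>x. smn c x \<in> jump B)"
    by (intro dec_oracle rec_intros)
  then show ?thesis unfolding jump_def using c by simp
qed

lemma jump_iff_conv: "e \<in> jump B \<longleftrightarrow> (\<exists>u. \<exists>y<u. conv B u e e y)"
proof
  assume "e \<in> jump B"
  then obtain y where "computes B e e y" unfolding jump_def by blast
  then obtain u where "conv B u e e y" by (rule computes_conv)
  then show "\<exists>u. \<exists>y<u. conv B u e e y" using conv_less(2) by blast
next
  assume "\<exists>u. \<exists>y<u. conv B u e e y"
  then show "e \<in> jump B" unfolding jump_def using conv_computes by blast
qed

lemma turing_le_jump:
  assumes "turing_le B C" shows "turing_le (jump B) (jump C)"
proof -
  have "dec_in B (\<lambda>q. p2 q \<in> B)" by (intro dec_oracle rec_intros)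
  then have "dec_in B (\<lambda>z. \<exists>y<p2 z. conv B (p2 z) (p1 z) (p1 z) y)"
    by (intro rec_intros)
  then have "dec_in (jump C) (\<lambda>e. \<exists>u. \<exists>y<u. conv B u e e y)"
    by (intro dec_in_jump_ex[of C "\<lambda>e u. \<exists>y<u. conv B u e e y"] dec_in_turing_le[OF assms])
  then show ?thesis unfolding turing_le_iff_dec_in jump_iff_conv .
qed

section \<open>Approximations that settle in the limit\<close>

lemma eventually_bounded:
  fixes k :: nat
  assumes "\<And>x. x < k \<Longrightarrow> \<exists>u. \<forall>v\<ge>u. Q x v"
  shows "\<exists>u. \<forall>v\<ge>u. \<forall>x<k. Q x (v :: nat)"
  using assms
proof (induction k)
  case (Suc k)
  have "\<exists>u. \<forall>v\<ge>u. Q x v" if "x < k" for x by (rule Suc.prems) (use that in simp)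
  from Suc.IH[OF this] obtain u1 where "\<forall>v\<ge>u1. \<forall>x<k. Q x v" by blast
  moreover obtain u2 where "\<forall>v\<ge>u2. Q k v" using Suc.prems[of k] by blast
  ultimately show ?case by (intro exI[of _ "max u1 u2"]) (auto simp: less_Suc_eq)
qed simp

lemma jump_stages_settle:
  "\<exists>t0. \<forall>t\<ge>t0. \<forall>i<u. i \<in> jump B \<longleftrightarrow> (\<exists>y<t. conv B t i i y)"
proof (rule eventually_bounded)
  fix i
  show "\<exists>t0. \<forall>t\<ge>t0. i \<in> jump B \<longleftrightarrow> (\<exists>y<t. conv B t i i y)"
  proof (cases "i \<in> jump B")
    case True
    then obtain v y where "conv B v i i y" unfolding jump_iff_conv by blast
    then show ?thesis using True conv_mono conv_less(2) by blast
  next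
    case False
    then show ?thesis unfolding jump_iff_conv by blast
  qed
qed

text \<open>
  The sets \<open>J t\<close> increase to the jump of \<open>B\<close>. A computation with oracle \<open>jump B\<close> fails to exist
  within the bound \<open>u\<close> iff it fails for arbitrarily late \<open>J t\<close>, which is a \<open>\<Pi>\<^sub>2\<close> property in \<open>B\<close>.
\<close>

lemma double_jump_totality:
  obtains g where "rec_in {} g"
    "\<And>e. e \<notin> jump (jump B) \<longleftrightarrow> (\<forall>m. \<exists>y. computes B (g e) m y)"
proof -
  define J where "J t = {i. \<exists>y<t. conv B t i i y}" for t
  \<comment> \<open>The input \<open>m\<close> codes a use bound \<open>p1 m\<close> and a lower
    bound \<open>p2 m\<close> for the stage \<open>t\<close>, so totality in \<open>m\<close> says
    that every bound fails at arbitrarily late stages.\<close>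
  define P where "P e m t \<longleftrightarrow> p2 m \<le> t \<and> \<not> (\<exists>y<p1 m. conv (J t) (p1 m) e e y)" for e m t
  have or: "dec_in B (\<lambda>q. p2 q \<in> B)" by (intro dec_oracle rec_intros)
  have J: "dec_in B (\<lambda>q. p2 q \<in> J (p1 q))"
    unfolding J_def mem_Collect_eq by (intro rec_intros or)
  have "dec_in B (\<lambda>z. P (p1 z) (p1 (p2 z)) (p2 (p2 z)))"
    unfolding P_def by (intro rec_intros dec_comp2[OF J])
  from param_search_index[OF this]
  obtain c where c: "\<And>e m. (\<exists>y. computes B (smn c e) m y) \<longleftrightarrow> (\<exists>t. P e m t)" by blast
  have settle: "\<exists>t0. \<forall>t\<ge>t0. \<forall>y. conv (J t) u e e y \<longleftrightarrow> conv (jump B) u e e y" for u e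
  proof -
    obtain t0 where "\<forall>t\<ge>t0. \<forall>i<u. i \<in> jump B \<longleftrightarrow> (\<exists>y<t. conv B t i i y)"
      using jump_stages_settle by blast
    then have "\<forall>t\<ge>t0. \<forall>i<u. i \<in> jump B \<longleftrightarrow> i \<in> J t" unfolding J_def by simp
    then show ?thesis using conv_local by (metis (no_types))
  qed
  have "e \<notin> jump (jump B) \<longleftrightarrow> (\<forall>m. \<exists>t. P e m t)" for e
  proof
    assume e: "e \<notin> jump (jump B)"
    show "\<forall>m. \<exists>t. P e m t"
    proof
      fix m
      obtain t0 where t0: "\<forall>t\<ge>t0. \<forall>y. conv (J t) (p1 m) e e y \<longleftrightarrow> conv (jump B) (p1 m) e e y"
        using settle by blast
      have "P e m (max t0 (p2 m))"
        unfolding P_def using t0 e conv_less(2) unfolding jump_iff_conv[of e "jump B"] by auto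
      then show "\<exists>t. P e m t" ..
    qed
  next
    assume all: "\<forall>m. \<exists>t. P e m t"
    show "e \<notin> jump (jump B)"
    proof
      assume "e \<in> jump (jump B)"
      then obtain u y where u: "y < u" "conv (jump B) u e e y" unfolding jump_iff_conv[of e "jump B"] by blast
      obtain t0 where t0: "\<forall>t\<ge>t0. \<forall>y. conv (J t) u e e y \<longleftrightarrow> conv (jump B) u e e y"
        using settle by blast
      \<comment> \<open>With \<open>t0\<close> as lower bound the failure occurs where the
        approximation is already correct for computations bounded by \<open>u\<close>.\<close>
      obtain t where "P e (pr u t0) t" using all by blast
      then show False using t0 u unfolding P_def by auto
    qed
  qed
  then show ?thesis using that[of "smn c"] c rec_smn[OF rec_id] by simp
qed

section \<open>Finite sequences coded by numbers\<close>

definition lookup :: "nat \<Rightarrow> nat \<Rightarrow> nat" where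
  "lookup w i = p1 ((p2 ^^ i) w)"

text \<open>Pairing extends a sequence at its front, so the table is built from its last entry
  backwards.\<close>

definition tabulate :: "(nat \<Rightarrow> nat) \<Rightarrow> nat \<Rightarrow> nat" where
  "tabulate F n = rec_nat 0 (\<lambda>k r. pr (F (n - Suc k)) r) n"

text \<open>Since 0 decodes to the pair of zeros, the code 0 stands for the constant sequence of
  zeros, and 0 is the value beyond the end of a table.\<close>

lemma lookup_0 [simp]: "lookup 0 i = 0"
proof -
  have "prod_decode 0 = (0, 0)" by (simp add: prod_decode_def prod_decode_aux.simps)
  moreover from this have "(p2 ^^ i) 0 = 0" by (induction i) simp_all
  ultimately show ?thesis unfolding lookup_def by simp
qed

lemma lookup_pr: "lookup (pr a w) i = (case i of 0 \<Rightarrow> a | Suc j \<Rightarrow> lookup w j)"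
  unfolding lookup_def by (auto split: nat.split simp: funpow_Suc_right simp del: funpow.simps)

lemma lookup_tabulate: "lookup (tabulate F n) i = (if i < n then F i else 0)"
proof -
  have "k \<le> n \<Longrightarrow>
    lookup (rec_nat 0 (\<lambda>k r. pr (F (n - Suc k)) r) k) i = (if i < k then F (n - k + i) else 0)" for k
  proof (induction k arbitrary: i)
    case (Suc k)
    have "n - k + j = n - Suc k + Suc j" for j using Suc.prems by simp
    then show ?case using Suc by (auto simp: lookup_pr split: nat.split)
  qed simp
  from this[of n] show ?thesis unfolding tabulate_def by simp
qed

lemma rec_lookup [rec_intros]:
  assumes "rec_in B f" "rec_in B g" shows "rec_in B (\<lambda>x. lookup (f x) (g x))"
proof -
  have eq: "(p2 ^^ i) w = rec_nat w (\<lambda>_ r. p2 r) i" for i w by (induction i) simp_all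
  show ?thesis unfolding lookup_def eq by (intro rec_intros assms)
qed

lemma rec_tabulate [rec_intros]:
  assumes F: "rec_in B (\<lambda>z. F (p1 z) (p2 z))" and "rec_in B n"
  shows "rec_in B (\<lambda>x. tabulate (F x) (n x))"
  unfolding tabulate_def
  by (intro rec_intros assms(2) rec_comp2[OF F] rec_comp[OF assms(2)])

lemma rec_sum_less:
  assumes F: "rec_in B (\<lambda>z. F (p1 z) (p2 z))" and "rec_in B n"
  shows "rec_in B (\<lambda>x. \<Sum>i<n x. F x i)"
proof -
  have "rec_in B (\<lambda>x. rec_nat 0 (\<lambda>k r. r + F x k) (n x))"
    by (intro rec_intros rec_comp2[OF F] assms(2))
  moreover have "rec_nat 0 (\<lambda>k r. r + f k) m = (\<Sum>i<m. f i)" for f :: "nat \<Rightarrow> nat" and m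
    by (induction m) simp_all
  ultimately show ?thesis by simp
qed

subsection \<open>Nodes of the tree of strategies\<close>

text \<open>
  Nodes of the binary tree are the positive numbers: 1 is the root and \<open>2 * a\<close>, \<open>2 * a + 1\<close> are the
  left and the right child of \<open>a\<close>. The number 0 is no node.
\<close>

definition anc :: "nat \<Rightarrow> nat \<Rightarrow> bool" where
  "anc a b \<longleftrightarrow> 0 < a \<and> (\<exists>k\<le>b. b div 2 ^ k = a)"

text \<open>\<open>c\<close> is the node where the two paths branch.\<close>

definition left :: "nat \<Rightarrow> nat \<Rightarrow> bool" where
  "left a b \<longleftrightarrow> (\<exists>c\<le>b. anc (2 * c) a \<and> anc (2 * c + 1) b)"

text \<open>The integer part of the binary logarithm, extended by 0 at 0.\<close>

definition lev :: "nat \<Rightarrow> nat" where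
  "lev a = (LEAST k. a div 2 ^ k \<le> 1)"

lemma dec_anc [rec_intros]:
  assumes "rec_in B f" "rec_in B g" shows "dec_in B (\<lambda>x. anc (f x) (g x))"
  unfolding anc_def by (intro rec_intros assms rec_comp[OF assms(1)] rec_comp[OF assms(2)])

lemma dec_left [rec_intros]:
  assumes "rec_in B f" "rec_in B g" shows "dec_in B (\<lambda>x. left (f x) (g x))"
  unfolding left_def by (intro rec_intros assms rec_comp[OF assms(1)] rec_comp[OF assms(2)])

lemma rec_lev [rec_intros]: assumes "rec_in B f" shows "rec_in B (\<lambda>x. lev (f x))"
proof -
  have "\<exists>k. x div 2 ^ k \<le> 1" for x :: nat
    by (metis div_eq_0_iff le0 less_exp)
  then have "rec_in B lev" unfolding lev_def
    by (intro rec_Least[of B "\<lambda>x k. x div 2 ^ k \<le> 1"]) (intro rec_intros)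
  then show ?thesis using rec_comp assms by blast
qed

lemma anc_iff: "anc a b \<longleftrightarrow> 0 < a \<and> (\<exists>k. b div 2 ^ k = a)"
proof -
  have "\<exists>k\<le>b. b div 2 ^ k = a" if "b div 2 ^ k = a" "0 < a" for k
  proof -
    have "2 ^ k \<le> b" using that by (metis div_less not_less less_irrefl)
    then have "k \<le> b" using less_exp[of k] by linarith
    then show ?thesis using that by blast
  qed
  then show ?thesis unfolding anc_def by blast
qed

lemma anc_step: "anc a b \<longleftrightarrow> 0 < a \<and> (a = b \<or> anc a (b div 2))"
proof
  assume "anc a b"
  then obtain k where k: "0 < a" "b div 2 ^ k = a" unfolding anc_iff by blast
  then show "0 < a \<and> (a = b \<or> anc a (b div 2))"
    unfolding anc_iff by (cases k) (auto simp: div_mult2_eq)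
next
  assume "0 < a \<and> (a = b \<or> anc a (b div 2))"
  moreover have "anc a b" if "0 < a" "a = b"
    unfolding anc_iff using that by (auto intro: exI[of _ 0])
  moreover have "anc a b" if anc: "anc a (b div 2)"
  proof -
    obtain k where "0 < a" "b div 2 div 2 ^ k = a" using anc unfolding anc_iff by blast
    then have "b div 2 ^ Suc k = a" by (simp add: div_mult2_eq)
    then show ?thesis unfolding anc_iff using \<open>0 < a\<close> by blast
  qed
  ultimately show "anc a b" by blast
qed

lemma anc_pos: "anc a b \<Longrightarrow> 0 < a" unfolding anc_def by simp

lemma anc_le: "anc a b \<Longrightarrow> a \<le> b" unfolding anc_def by auto

lemma anc_pos2: "anc a b \<Longrightarrow> 0 < b" using anc_le anc_pos by fastforce

lemma anc_refl [simp]: "anc a a \<longleftrightarrow> 0 < a" using anc_step anc_pos by blast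

lemma not_anc_0 [simp]: "\<not> anc a 0" "\<not> anc 0 a" using anc_le anc_pos by fastforce+

lemma anc_trans: "anc a b \<Longrightarrow> anc b c \<Longrightarrow> anc a c"
proof (induction c rule: less_induct)
  case (less c)
  show ?case
  proof (cases "b = c")
    case False
    then have "anc b (c div 2)" using less.prems(2) anc_step by blast
    moreover have "c div 2 < c" using anc_pos2[OF less.prems(2)] by simp
    ultimately show ?thesis using less.IH less.prems(1) anc_step anc_pos by blast
  qed (use less in simp)
qed

lemma anc_antisym: "anc a b \<Longrightarrow> anc b a \<Longrightarrow> a = b"
  using anc_le by (simp add: le_antisym)

lemma anc_1 [simp]: "anc 1 a \<longleftrightarrow> 0 < a" "anc (Suc 0) a \<longleftrightarrow> 0 < a"
proof -
  have "0 < a \<Longrightarrow> anc 1 a"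
  proof (induction a rule: less_induct)
    case (less a)
    then show ?case using less.IH[of "a div 2"] anc_step[of 1 a] by (cases "a = 1") auto
  qed
  then show "anc 1 a \<longleftrightarrow> 0 < a" "anc (Suc 0) a \<longleftrightarrow> 0 < a" using anc_pos2 by auto
qed

lemma anc_of_1 [simp]: "anc a 1 \<longleftrightarrow> a = 1" "anc a (Suc 0) \<longleftrightarrow> a = Suc 0"
  using anc_le[of a 1] anc_pos[of a 1] by auto

lemma anc_double [simp]: "anc a (2 * b) \<longleftrightarrow> 0 < a \<and> (a = 2 * b \<or> anc a b)"
  "anc a (2 * b + 1) \<longleftrightarrow> 0 < a \<and> (a = 2 * b + 1 \<or> anc a b)"
  "anc a (Suc (2 * b)) \<longleftrightarrow> 0 < a \<and> (a = 2 * b + 1 \<or> anc a b)"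
  using anc_step[of a "2 * b"] anc_step[of a "2 * b + 1"] by auto

lemma anc_parent: "anc (2 * a) b \<Longrightarrow> anc a b" "anc (2 * a + 1) b \<Longrightarrow> 0 < a \<Longrightarrow> anc a b"
  "anc (Suc (2 * a)) b \<Longrightarrow> 0 < a \<Longrightarrow> anc a b"
  using anc_trans[of a "2 * a" b] anc_trans[of a "2 * a + 1" b] anc_pos[of "2 * a" b] by auto

lemma anc_div2: "1 < a \<Longrightarrow> anc (a div 2) a"
  using anc_step[of "a div 2" a] by auto

lemma anc_div2_trans: "1 < a \<Longrightarrow> anc a b \<Longrightarrow> anc (a div 2) b"
  using anc_div2 anc_trans by blast

lemma anc_linear: "anc a c \<Longrightarrow> anc b c \<Longrightarrow> anc a b \<or> anc b a"
proof (induction c rule: less_induct)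
  case (less c)
  show ?case
  proof (cases "a = c \<or> b = c")
    case False
    then have "anc a (c div 2)" "anc b (c div 2)" using less.prems anc_step by blast+
    moreover have "c div 2 < c" using anc_pos2[OF less.prems(2)] by simp
    ultimately show ?thesis using less.IH by blast
  qed (use less in auto)
qed

lemma anc_child: "anc a b \<Longrightarrow> a = b \<or> anc (2 * a) b \<or> anc (2 * a + 1) b"
proof (induction b rule: less_induct)
  case (less b)
  show ?case
  proof (cases "a = b")
    case False
    then have p: "anc a (b div 2)" using less.prems anc_step by blast
    moreover have lt: "b div 2 < b" using anc_pos2[OF less.prems] by simp
    ultimately consider "a = b div 2" | "anc (2 * a) (b div 2)" | "anc (2 * a + 1) (b div 2)"
      using less.IH by blast
    then show ?thesis
    proof cases
      case 1
      then have "b = 2 * a \<or> b = 2 * a + 1" by presburger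
      then show ?thesis using anc_pos[OF p] by auto
    next
      case 2 then show ?thesis using anc_step[of "2 * a" b] anc_pos by blast
    next
      case 3 then show ?thesis using anc_step[of "2 * a + 1" b] by simp
    qed
  qed simp
qed

lemma anc_siblings: "anc (2 * a) b \<Longrightarrow> \<not> anc (2 * a + 1) b" "anc (2 * a) b \<Longrightarrow> \<not> anc (Suc (2 * a)) b"
proof -
  show "anc (2 * a) b \<Longrightarrow> \<not> anc (2 * a + 1) b"
  proof
    assume h: "anc (2 * a) b" "anc (2 * a + 1) b"
    then have "0 < a" using anc_pos by fastforce
    from anc_linear[OF h] show False
    proof
      assume "anc (2 * a) (2 * a + 1)"
      then have "anc (2 * a) a" by simp
      then show False using anc_le \<open>0 < a\<close> by fastforce
    next
      assume "anc (2 * a + 1) (2 * a)" then show False using anc_le by fastforce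
    qed
  qed
  then show "anc (2 * a) b \<Longrightarrow> \<not> anc (Suc (2 * a)) b" by simp
qed

section \<open>The left-to-right order of nodes\<close>

lemma left_iff: "left a b \<longleftrightarrow> (\<exists>c. anc (2 * c) a \<and> anc (2 * c + 1) b)"
proof -
  have "c \<le> b" if "anc (2 * c + 1) b" for c using anc_le[OF that] by simp
  then show ?thesis unfolding left_def by blast
qed

lemma leftE:
  assumes "left a b" obtains c where "0 < c" "anc (2 * c) a" "anc (2 * c + 1) b" "anc c a" "anc c b"
proof -
  obtain c where c: "anc (2 * c) a" "anc (2 * c + 1) b" using assms unfolding left_iff by blast
  then have "0 < c" using anc_pos by fastforce
  then show ?thesis using that c anc_parent by blast
qed

lemma left_extend1: "left a b \<Longrightarrow> anc a a' \<Longrightarrow> left a' b"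
  unfolding left_iff using anc_trans by blast

lemma left_extend2: "left a b \<Longrightarrow> anc b b' \<Longrightarrow> left a b'"
  unfolding left_iff using anc_trans by blast

lemma left_not_anc: assumes "left a b" shows "\<not> anc a b" "\<not> anc b a"
proof -
  obtain c where c: "anc (2 * c) a" "anc (2 * c + 1) b" using assms unfolding left_iff by blast
  show "\<not> anc a b" using c anc_siblings anc_trans by blast
  show "\<not> anc b a" using c anc_siblings anc_trans by blast
qed

lemma left_asym: "left a b \<Longrightarrow> \<not> left b a"
proof
  assume "left a b" "left b a"
  then obtain c d where c: "0 < c" "anc (2 * c) a" "anc (2 * c + 1) b" "anc c a" "anc c b"
    and d: "0 < d" "anc (2 * d) b" "anc (2 * d + 1) a" "anc d b" "anc d a" by (metis leftE)
  from anc_linear[OF c(4) d(5)] show False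
  proof
    assume "anc c d"
    then consider "c = d" | "anc (2 * c) d" | "anc (2 * c + 1) d" using anc_child by blast
    then show False
      by cases (use c d anc_siblings anc_trans in blast)+
  next
    assume "anc d c"
    then consider "c = d" | "anc (2 * d) c" | "anc (2 * d + 1) c" using anc_child by blast
    then show False
      by cases (use c d anc_siblings anc_trans in blast)+
  qed
qed

lemma left_irrefl [simp]: "\<not> left a a" using left_asym by blast

text \<open>Compare \<open>c\<close> with the node where \<open>a\<close> and \<open>b\<close>
  branch: at it or above it, \<open>c\<close> lies on the path to \<open>a\<close>; below it,
  \<open>c\<close> lies in the right subtree.\<close>

lemma left_prefix2: "left a b \<Longrightarrow> anc c b \<Longrightarrow> left a c \<or> anc c a"
proof -
  assume "left a b" and c: "anc c b"
  then obtain d where d: "anc (2 * d) a" "anc (2 * d + 1) b" "anc d a" by (metis leftE)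
  from anc_linear[OF c d(2)] show ?thesis
  proof
    assume "anc c (2 * d + 1)"
    then have "c = 2 * d + 1 \<or> anc c d" by simp
    then show ?thesis using d c anc_trans unfolding left_iff
      by (metis anc_pos anc_refl)
  next
    assume "anc (2 * d + 1) c" then show ?thesis using d(1) unfolding left_iff by blast
  qed
qed

lemma trichotomy:
  "0 < a \<Longrightarrow> 0 < b \<Longrightarrow> anc a b \<or> anc b a \<or> left a b \<or> left b a"
proof (induction a arbitrary: b rule: less_induct)
  case (less a)
  show ?case
  proof (cases "a = 1")
    case False
    then have a: "0 < a div 2" "a div 2 < a" "anc (a div 2) a" using less.prems anc_div2 by auto
    from less.IH[OF a(2,1) less.prems(2)]
    consider "anc (a div 2) b" | "anc b (a div 2)" | "left (a div 2) b" | "left b (a div 2)" by blast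
    then show ?thesis
    proof cases
      case 1
      define p where "p = a div 2"
      have pa: "a = 2 * p \<or> a = 2 * p + 1" unfolding p_def by presburger
      have "p = b \<or> anc (2 * p) b \<or> anc (2 * p + 1) b" using anc_child 1 p_def by blast
      then show ?thesis using pa a(3) less.prems unfolding left_iff p_def
        by (metis anc_refl)
    next
      case 2 then show ?thesis using a(3) anc_trans by blast
    next
      case 3 then show ?thesis using a(3) left_extend1 by blast
    next
      case 4 then show ?thesis using a(3) left_extend2 by blast
    qed
  qed (use less in simp)
qed

lemma lev_1 [simp]: "lev 1 = 0" "lev (Suc 0) = 0" "lev 0 = 0"
  unfolding lev_def by (rule Least_eq_0, simp)+

lemma lev_div2: assumes "1 < a" shows "lev a = Suc (lev (a div 2))"
proof -
  have ex: "a div 2 ^ a \<le> 1" by (simp add: less_exp)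
  have "lev a = Suc (LEAST k. a div 2 ^ Suc k \<le> 1)"
    unfolding lev_def by (rule Least_Suc[where n = a]) (use ex assms in auto)
  then show ?thesis unfolding lev_def by (simp add: div_mult2_eq)
qed

lemma lev_double [simp]: "0 < a \<Longrightarrow> lev (2 * a) = Suc (lev a)" "0 < a \<Longrightarrow> lev (2 * a + 1) = Suc (lev a)"
  "0 < a \<Longrightarrow> lev (Suc (2 * a)) = Suc (lev a)"
  using lev_div2[of "2 * a"] lev_div2[of "2 * a + 1"] by simp_all

lemma lev_anc: "anc a b \<Longrightarrow> lev a \<le> lev b"
proof (induction b rule: less_induct)
  case (less b)
  show ?case
  proof (cases "a = b")
    case False
    then have p: "anc a (b div 2)" using less.prems anc_step by blast
    then have "1 < b" using anc_pos2[OF p] by simp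
    then show ?thesis using less.IH[OF _ p] lev_div2[of b] by simp
  qed simp
qed

lemma lev_anc_eq: "anc a b \<Longrightarrow> lev a = lev b \<Longrightarrow> a = b"
proof (rule ccontr)
  assume a: "anc a b" "lev a = lev b" "a \<noteq> b"
  then consider "anc (2 * a) b" | "anc (2 * a + 1) b" using anc_child by blast
  then show False using lev_anc[of "2 * a" b] lev_anc[of "2 * a + 1" b] a anc_pos[OF a(1)]
    by cases auto
qed

lemma anc_by_lev: "anc a c \<Longrightarrow> anc b c \<Longrightarrow> lev a \<le> lev b \<Longrightarrow> anc a b"
  using anc_linear lev_anc lev_anc_eq by (metis anc_pos anc_refl le_antisym)

subsection \<open>The construction\<close>

text \<open>
  At stage \<open>s\<close> the token function \<open>K\<close> gives for each \<open>x\<close> the node that its token occupies, 0 if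
  there is no token and 1 (the root) if \<open>x\<close> has entered \<open>A\<close>; \<open>E r\<close> is the last node visited at
  stage \<open>r < s\<close>, the nodes visited at \<open>r\<close> being its ancestors.
\<close>

definition total_guess :: "(nat \<Rightarrow> nat) \<Rightarrow> (nat \<Rightarrow> nat) \<Rightarrow> nat \<Rightarrow> nat \<Rightarrow> bool" where
  "total_guess K E s a \<longleftrightarrow>
    (\<forall>r<s. anc (2 * a) (E r) \<longrightarrow> (\<forall>m\<le>r. \<exists>y<s. conv {x. K x = 1} s (lev a) m y))"

text \<open>\<open>2 * a \<le> x\<close> keeps the complement infinite, and the lower bound by
  stages makes \<open>x\<close> new with respect to visits on the left. The bound \<open>x\<close>
  inside \<open>conv\<close> places \<open>x\<close> beyond the uses to be protected.\<close>

definition eligible :: "(nat \<Rightarrow> nat) \<Rightarrow> (nat \<Rightarrow> nat) \<Rightarrow> nat \<Rightarrow> nat \<Rightarrow> nat \<Rightarrow> bool" where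
  "eligible K E s a x \<longleftrightarrow> (\<exists>y<s. conv {} s (lev a) x y) \<and> 2 * a \<le> x \<and>
    (\<forall>r<s. left (E r) a \<longrightarrow> r \<le> x) \<and>
    (\<forall>c\<le>a. anc (2 * c) a \<longrightarrow> (\<forall>m\<le>lev a. \<exists>y<x. conv {x. K x = 1} x (lev c) m y))"

definition wants :: "(nat \<Rightarrow> nat) \<Rightarrow> (nat \<Rightarrow> nat) \<Rightarrow> nat \<Rightarrow> nat \<Rightarrow> bool" where
  "wants K E s a \<longleftrightarrow> (\<forall>x<s. (\<exists>y<s. conv {} s (lev a) x y) \<longrightarrow> K x \<noteq> 1) \<and>
    (\<exists>x<s. eligible K E s a x)"

text \<open>The root is excluded in the first clause because a token there marks an element of
  \<open>A\<close> and has arrived.\<close>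

definition acts :: "(nat \<Rightarrow> nat) \<Rightarrow> (nat \<Rightarrow> nat) \<Rightarrow> nat \<Rightarrow> nat \<Rightarrow> bool" where
  "acts K E s a \<longleftrightarrow> 1 < a \<and> (\<exists>x<s. K x = a) \<or> wants K E s a"

definition next_node :: "(nat \<Rightarrow> nat) \<Rightarrow> (nat \<Rightarrow> nat) \<Rightarrow> nat \<Rightarrow> nat \<Rightarrow> nat" where
  "next_node K E s a =
    (if acts K E s a then a else if total_guess K E s a then 2 * a else 2 * a + 1)"

text \<open>A node that acts is fixed by \<open>next_node\<close>, so the iteration stops there;
  otherwise \<open>k\<close> rounds reach level \<open>k\<close>.\<close>

definition walk :: "(nat \<Rightarrow> nat) \<Rightarrow> (nat \<Rightarrow> nat) \<Rightarrow> nat \<Rightarrow> nat \<Rightarrow> nat" where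
  "walk K E s k = rec_nat 1 (\<lambda>_ a. next_node K E s a) k"

definition requests :: "(nat \<Rightarrow> nat) \<Rightarrow> (nat \<Rightarrow> nat) \<Rightarrow> nat \<Rightarrow> nat \<Rightarrow> nat \<Rightarrow> bool" where
  "requests K E s a x \<longleftrightarrow> \<not> (1 < a \<and> (\<exists>z<s. K z = a)) \<and> wants K E s a \<and>
    eligible K E s a x \<and> (\<forall>y<x. \<not> eligible K E s a y)"

definition update :: "(nat \<Rightarrow> nat) \<Rightarrow> (nat \<Rightarrow> nat) \<Rightarrow> nat \<Rightarrow> nat \<Rightarrow> nat \<Rightarrow> nat" where
  "update K E s a x =
    (if 1 < a \<and> K x = a then a div 2
     else if requests K E s a x then a
     else if left a (K x) then 0 else K x)"

text \<open>The state carries the whole history of visits, as guesses and eligibility look back to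
  all earlier stages; thus a course-of-values recursion becomes primitive.\<close>

definition step :: "nat \<Rightarrow> nat \<Rightarrow> nat" where
  "step s w = pr
    (tabulate (\<lambda>x. update (lookup (p1 w)) (lookup (p2 w)) s (walk (lookup (p1 w)) (lookup (p2 w)) s s) x) (Suc s))
    (tabulate (\<lambda>r. if r = s then walk (lookup (p1 w)) (lookup (p2 w)) s s else lookup (p2 w) r) (Suc s))"

definition state :: "nat \<Rightarrow> nat" where
  "state s = rec_nat 0 (\<lambda>s w. step s w) s"

definition tok :: "nat \<Rightarrow> nat \<Rightarrow> nat" where
  "tok s = lookup (p1 (state s))"

definition last_node :: "nat \<Rightarrow> nat" where
  "last_node s = lookup (p2 (state (Suc s))) s"

lemma dec_mem_Collect [rec_intros]:
  "dec_in B (\<lambda>x. P x (f x)) \<Longrightarrow> dec_in B (\<lambda>x. f x \<in> {y. P x y})"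
  by simp

lemma dec_mem_empty [rec_intros]: "dec_in B (\<lambda>x. f x \<in> {})"
  by (simp add: dec_const)

lemma rec_walk [rec_intros]:
  assumes "rec_in B w" "rec_in B v" "rec_in B s" "rec_in B k"
  shows "rec_in B (\<lambda>x. walk (lookup (w x)) (lookup (v x)) (s x) (k x))"
  unfolding walk_def next_node_def acts_def wants_def eligible_def total_guess_def
  by (intro rec_intros assms rec_comp[OF assms(1)] rec_comp[OF assms(2)] rec_comp[OF assms(3)])

lemma rec_update [rec_intros]:
  assumes "rec_in B w" "rec_in B v" "rec_in B s" "rec_in B a" "rec_in B y"
  shows "rec_in B (\<lambda>x. update (lookup (w x)) (lookup (v x)) (s x) (a x) (y x))"
  unfolding update_def requests_def wants_def eligible_def
  by (intro rec_intros assms rec_comp[OF assms(1)] rec_comp[OF assms(2)] rec_comp[OF assms(3)]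
      rec_comp[OF assms(4)] rec_comp[OF assms(5)])

lemma rec_state [rec_intros]: assumes "rec_in B s" shows "rec_in B (\<lambda>x. state (s x))"
  unfolding state_def step_def by (intro rec_intros assms)

lemma rec_tok [rec_intros]:
  assumes "rec_in B s" "rec_in B f" shows "rec_in B (\<lambda>x. tok (s x) (f x))"
  unfolding tok_def by (intro rec_intros assms)

lemma rec_last_node [rec_intros]:
  assumes "rec_in B s" shows "rec_in B (\<lambda>x. last_node (s x))"
  unfolding last_node_def by (intro rec_intros assms)

section \<open>Recursion equations of the construction\<close>

lemma total_guess_cong:
  "(\<And>r. r < s \<Longrightarrow> E r = E' r) \<Longrightarrow> total_guess K E s = total_guess K E' s"
  unfolding total_guess_def by (intro ext) auto

lemma eligible_cong:
  "(\<And>r. r < s \<Longrightarrow> E r = E' r) \<Longrightarrow> eligible K E s = eligible K E' s"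
  unfolding eligible_def by (intro ext) auto

text \<open>Stage \<open>s\<close> consults the history only below \<open>s\<close>, where the
  stored table agrees with \<open>last_node\<close>.\<close>

lemma update_cong:
  assumes "\<And>r. r < s \<Longrightarrow> E r = E' r" shows "update K E s = update K E' s"
proof -
  have "eligible K E s = eligible K E' s" by (rule eligible_cong) (rule assms)
  then show ?thesis unfolding update_def requests_def wants_def by (simp only:)
qed

lemma walk_cong:
  assumes "\<And>r. r < s \<Longrightarrow> E r = E' r" shows "walk K E s = walk K E' s"
proof -
  have "eligible K E s = eligible K E' s" by (rule eligible_cong) (rule assms)
  moreover have "total_guess K E s = total_guess K E' s" by (rule total_guess_cong) (rule assms)
  ultimately show ?thesis unfolding walk_def next_node_def acts_def wants_def by (simp only:)
qed

lemma state_Suc: "state (Suc s) = step s (state s)"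
  unfolding state_def by simp

lemma history_eq: "r < s \<Longrightarrow> lookup (p2 (state s)) r = last_node r"
proof (induction s)
  case (Suc s)
  show ?case
  proof (cases "r = s")
    case True then show ?thesis unfolding last_node_def by simp
  next
    case False
    then have "lookup (p2 (state (Suc s))) r = lookup (p2 (state s)) r"
      using Suc.prems unfolding state_Suc step_def by (simp add: lookup_tabulate)
    then show ?thesis using Suc False by simp
  qed
qed simp

lemma last_node_eq: "last_node s = walk (tok s) last_node s s"
proof -
  have "last_node s = walk (tok s) (lookup (p2 (state s))) s s"
    unfolding last_node_def[of s] state_Suc step_def tok_def by (simp add: lookup_tabulate)
  then show ?thesis using walk_cong[of s "lookup (p2 (state s))" last_node] history_eq by simp
qed

lemma tok_0: "tok 0 x = 0"
proof -
  have "p1 0 = 0" using lookup_0[of 0] unfolding lookup_def by simp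
  then show ?thesis unfolding tok_def state_def by simp
qed

lemma tok_Suc:
  "tok (Suc s) x = (if x \<le> s then update (tok s) last_node s (last_node s) x else 0)"
proof -
  have w: "walk (tok s) (lookup (p2 (state s))) s s = last_node s"
    using last_node_eq walk_cong[of s "lookup (p2 (state s))" last_node] history_eq by simp
  have "tok (Suc s) x = (if x \<le> s then update (tok s) (lookup (p2 (state s))) s (last_node s) x else 0)"
    unfolding w[symmetric]
    unfolding tok_def state_Suc step_def by (simp add: lookup_tabulate less_Suc_eq_le)
  then show ?thesis using update_cong[of s "lookup (p2 (state s))" last_node] history_eq by simp
qed

lemma walk_0 [simp]: "walk K E s 0 = 1" unfolding walk_def by simp

lemma walk_Suc [simp]: "walk K E s (Suc k) = next_node K E s (walk K E s k)"
  unfolding walk_def by simp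

lemma walk_pos: "0 < walk K E s k"
  by (induction k) (auto simp: next_node_def)

lemma walk_ancestors:
  assumes "anc a (walk K E s k)" "a \<noteq> walk K E s k"
  shows "\<not> acts K E s a" "anc (2 * a) (walk K E s k) \<longleftrightarrow> total_guess K E s a"
proof -
  have "\<not> acts K E s a \<and> (anc (2 * a) (walk K E s k) \<longleftrightarrow> total_guess K E s a)"
    using assms
  proof (induction k)
    case (Suc k)
    let ?b = "walk K E s k"
    show ?case
    proof (cases "acts K E s ?b")
      case True then show ?thesis using Suc by (simp add: next_node_def)
    next
      case False
      then have n: "walk K E s (Suc k) = (if total_guess K E s ?b then 2 * ?b else 2 * ?b + 1)"
        by (simp add: next_node_def)
      have b: "0 < ?b" by (rule walk_pos)
      have a: "anc a ?b" using Suc.prems n by (auto split: if_splits)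
      then have "0 < a" by (rule anc_pos)
      show ?thesis
      proof (cases "a = ?b")
        case True
        have "\<not> anc (2 * ?b) (2 * ?b + 1)"
          using b anc_le[of "2 * ?b" ?b] by auto
        then show ?thesis using False True n b by (auto split: if_splits)
      next
        case ne: False
        have "anc (2 * a) (walk K E s (Suc k)) \<longleftrightarrow> anc (2 * a) ?b"
          using n ne \<open>0 < a\<close> by (auto; presburger)
        then show ?thesis using Suc.IH[OF a ne] by simp
      qed
    qed
  qed simp
  then show "\<not> acts K E s a" "anc (2 * a) (walk K E s k) \<longleftrightarrow> total_guess K E s a" by auto
qed

text \<open>Every round that does not end at an acting node raises the level by one.\<close>

lemma walk_stops: "lev (walk K E s k) < k \<Longrightarrow> acts K E s (walk K E s k)"
proof (induction k)
  case (Suc k)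
  have b: "0 < walk K E s k" by (rule walk_pos)
  show ?case
  proof (cases "acts K E s (walk K E s k)")
    case True then show ?thesis by (simp add: next_node_def)
  next
    case False
    then have "lev (walk K E s (Suc k)) = Suc (lev (walk K E s k))"
      using b by (simp add: next_node_def)
    then show ?thesis using Suc False by simp
  qed
qed simp

subsection \<open>The true path\<close>

abbreviation guess :: "nat \<Rightarrow> nat \<Rightarrow> bool" where "guess s \<equiv> total_guess (tok s) last_node s"
abbreviation elig :: "nat \<Rightarrow> nat \<Rightarrow> nat \<Rightarrow> bool" where "elig s \<equiv> eligible (tok s) last_node s"
abbreviation act :: "nat \<Rightarrow> nat \<Rightarrow> bool" where "act s \<equiv> acts (tok s) last_node s"
abbreviation req :: "nat \<Rightarrow> nat \<Rightarrow> bool" where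
  "req s \<equiv> requests (tok s) last_node s (last_node s)"

definition simp_set :: "nat set" where
  "simp_set = {x. \<exists>s. tok s x = 1}"

lemma last_node_pos [simp]: "0 < last_node s"
  using walk_pos last_node_eq by metis

lemma last_node_neq_0 [simp]: "last_node s \<noteq> 0"
  using last_node_pos by (metis less_irrefl)

lemma tok_less: "tok s x \<noteq> 0 \<Longrightarrow> x < s"
  by (cases s) (auto simp: tok_0 tok_Suc split: if_splits)

lemma elig_less: "elig s a x \<Longrightarrow> x < s"
  unfolding eligible_def using conv_less by blast

lemma req_elig: "req s x \<Longrightarrow> elig s (last_node s) x"
  unfolding requests_def by blast

lemma req_less: "req s x \<Longrightarrow> x < s"
  using elig_less req_elig by blast

lemma req_unique: "req s x \<Longrightarrow> req s y \<Longrightarrow> x = y"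
  unfolding requests_def by (meson linorder_neqE_nat)

lemma req_not_in: assumes "req s x" shows "tok s x \<noteq> 1"
proof -
  have "\<exists>y<s. conv {} s (lev (last_node s)) x y"
    using req_elig[OF assms] unfolding eligible_def by blast
  then show ?thesis using assms req_less[OF assms] unfolding requests_def wants_def by blast
qed

lemma req_not_at: assumes "req s x" "1 < last_node s" shows "tok s z \<noteq> last_node s"
proof
  assume z: "tok s z = last_node s"
  then have "z < s" using tok_less[of s z] by simp
  then show False using assms z unfolding requests_def by blast
qed

lemma req_not_self: assumes "req s x" shows "tok s x \<noteq> last_node s"
proof (cases "1 < last_node s")
  case True then show ?thesis using req_not_at assms by blast
next
  case False
  then have "last_node s = 1" using last_node_pos[of s] by linarith
  then show ?thesis using req_not_in[OF assms] by simp
qed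

section \<open>Motion of the tokens\<close>

lemma tok_step:
  "tok (Suc s) x = (if 1 < last_node s \<and> tok s x = last_node s then last_node s div 2
    else if req s x then last_node s else if left (last_node s) (tok s x) then 0 else tok s x)"
proof (cases "x \<le> s")
  case True then show ?thesis by (simp add: tok_Suc update_def)
next
  case False
  then have "tok s x = 0" "\<not> req s x" using tok_less req_less by (meson less_imp_le_nat)+
  then show ?thesis using False by (simp add: tok_Suc)
qed

lemma tok_step_cases:
  obtains (move) "1 < last_node s" "tok s x = last_node s" "tok (Suc s) x = last_node s div 2" "\<not> req s x"
    | (request) "req s x" "tok (Suc s) x = last_node s"
    | (cancel) "\<not> req s x" "left (last_node s) (tok s x)" "tok (Suc s) x = 0"
    | (stay) "\<not> req s x" "\<not> left (last_node s) (tok s x)" "tok (Suc s) x = tok s x"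
proof -
  have "\<not> req s x" if "tok s x = last_node s" using req_not_self that by blast
  then show ?thesis using that tok_step[of s x] by metis
qed

lemma tok_1_Suc: assumes "tok s x = 1" shows "tok (Suc s) x = 1"
proof (cases rule: tok_step_cases[of s x])
  case request then show ?thesis using req_not_in assms by blast
next
  case cancel then show ?thesis using left_not_anc(2)[of "last_node s" 1] assms by simp
qed (use assms in auto)

lemma tok_1_mono: assumes "tok s x = 1" "s \<le> t" shows "tok t x = 1"
  using assms(2) by (induction t rule: dec_induct) (use assms tok_1_Suc in auto)

lemma below_last:
  assumes "anc a (last_node s)" "a \<noteq> last_node s"
  shows "\<not> act s a" "anc (2 * a) (last_node s) \<longleftrightarrow> guess s a"
  using walk_ancestors[of a "tok s" last_node s s] assms last_node_eq[of s] by simp_all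

text \<open>A token at a node other than the root would have made this node act, and the walk would
  have ended there.\<close>

lemma below_last_tok:
  assumes "anc a (last_node s)" "a \<noteq> last_node s" "tok s x = a"
  shows "a = 1"
proof (rule ccontr)
  assume "a \<noteq> 1"
  then have "1 < a" using anc_pos[OF assms(1)] by simp
  moreover have "x < s" using tok_less assms(3) calculation by force
  ultimately have "act s a" unfolding acts_def using assms(3) by blast
  then show False using below_last(1) assms by blast
qed

lemma last_node_stops: "lev (last_node s) < s \<Longrightarrow> act s (last_node s)"
  using walk_stops[of "tok s" last_node s s] last_node_eq[of s] by simp

text \<open>\<open>r\<close> is the stage of the latest request; from then on the token has only
  moved towards the root.\<close>

lemma origin:
  "tok t x \<noteq> 0 \<Longrightarrow> \<exists>r<t. req r x \<and> (\<forall>v. r < v \<and> v < t \<longrightarrow> \<not> req v x) \<and>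
    (\<forall>v. r < v \<and> v \<le> t \<longrightarrow> tok v x \<noteq> 0 \<and> anc (tok v x) (last_node r) \<and> anc (tok t x) (tok v x))"
proof (induction t)
  case (Suc t)
  have "\<exists>r<Suc t. req r x \<and> (\<forall>v. r < v \<and> v < Suc t \<longrightarrow> \<not> req v x) \<and>
    (\<forall>v. r < v \<and> v \<le> Suc t \<longrightarrow> tok v x \<noteq> 0 \<and> anc (tok v x) (last_node r) \<and> anc (tok (Suc t) x) (tok v x))"
    if n: "\<not> req t x" "tok t x \<noteq> 0" and a: "anc (tok (Suc t) x) (tok t x)"
  proof -
    obtain r where r: "r < t" "req r x" "\<forall>v. r < v \<and> v < t \<longrightarrow> \<not> req v x"
      "\<forall>v. r < v \<and> v \<le> t \<longrightarrow> tok v x \<noteq> 0 \<and> anc (tok v x) (last_node r) \<and> anc (tok t x) (tok v x)"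
      using Suc.IH n(2) by blast
    have "tok v x \<noteq> 0 \<and> anc (tok v x) (last_node r) \<and> anc (tok (Suc t) x) (tok v x)"
      if v: "r < v" "v \<le> Suc t" for v
    proof (cases "v = Suc t")
      case True
      have "anc (tok t x) (last_node r)" using r(1,4) by simp
      then show ?thesis using a anc_trans anc_pos[OF a] True by auto
    next
      case False
      then have "v \<le> t" using v(2) by simp
      then show ?thesis using r(4) v(1) a anc_trans by blast
    qed
    then show ?thesis using r n(1) by (intro exI[of _ r]) (auto simp: less_Suc_eq)
  qed note keep = this
  show ?case
  proof (cases rule: tok_step_cases[of t x])
    case move
    then show ?thesis using keep anc_div2 by simp
  next
    case request
    have "v = Suc t" if "t < v" "v \<le> Suc t" for v using that by simp
    then show ?thesis using request by (intro exI[of _ t]) fastforce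
  next
    case cancel then show ?thesis using Suc.prems by simp
  next
    case stay then show ?thesis using keep Suc.prems by simp
  qed
qed (simp add: tok_0)

text \<open>Visits to the left are excluded before the request by eligibility and after it by
  cancellation. The request itself is a visit at or below the present position, at a stage later
  than \<open>x\<close>.\<close>

lemma tok_visits:
  assumes "tok t x \<noteq> 0"
  shows "\<And>v. x < v \<Longrightarrow> v < t \<Longrightarrow> \<not> left (last_node v) (tok t x)"
    and "\<exists>v. x < v \<and> v < t \<and> anc (tok t x) (last_node v)"
proof -
  obtain r where r: "r < t" "req r x" "\<forall>v. r < v \<and> v < t \<longrightarrow> \<not> req v x"
    "\<forall>v. r < v \<and> v \<le> t \<longrightarrow> tok v x \<noteq> 0 \<and> anc (tok v x) (last_node r) \<and> anc (tok t x) (tok v x)"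
    using origin[OF assms] by blast
  have a: "anc (tok t x) (last_node r)" using r(1,4) by auto
  then show "\<exists>v. x < v \<and> v < t \<and> anc (tok t x) (last_node v)" using r(1) req_less[OF r(2)] by blast
  fix v assume v: "x < v" "v < t"
  show "\<not> left (last_node v) (tok t x)"
  proof
    assume l: "left (last_node v) (tok t x)"
    consider "v < r" | "v = r" | "r < v" by linarith
    then show False
    proof cases
      case 1
      then have "v \<le> x"
        using left_extend2[OF l a] req_elig[OF r(2)] unfolding eligible_def by blast
      then show False using v(1) by simp
    next
      case 2 then show False using left_not_anc(2)[OF l] a by blast
    next
      case 3
      then have tv: "anc (tok t x) (tok v x)" "tok (Suc v) x \<noteq> 0" "\<not> req v x"
        using r(3,4) v(2) by auto
      then have l': "left (last_node v) (tok v x)" using l left_extend2 by blast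
      show False
        by (cases rule: tok_step_cases[of v x]) (use tv l' in auto)
    qed
  qed
qed

text \<open>Moves lead to ancestors, and cancellation would take a visit to the left of
  \<open>a\<close>. The delicate case is a repeated request for \<open>x\<close>; it can only come
  from an ancestor of the present position.\<close>

lemma persist:
  assumes "tok r x \<noteq> 0" "anc (tok r x) a" and nl: "\<And>u. r \<le> u \<Longrightarrow> \<not> left (last_node u) a"
    and "r \<le> u"
  shows "tok u x \<noteq> 0 \<and> anc (tok u x) a"
  using assms(4)
proof (induction u rule: dec_induct)
  case base then show ?case using assms by simp
next
  case (step u)
  then have tu: "tok u x \<noteq> 0" "anc (tok u x) a" by auto
  show ?case
  proof (cases rule: tok_step_cases[of u x])
    case move
    then show ?thesis using tu anc_div2_trans anc_pos by (metis not_anc_0(2))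
  next
    case request
    let ?e = "last_node u"
    have n1: "tok u x \<noteq> 1" using req_not_in request by blast
    have ne: "tok u x \<noteq> ?e" using req_not_self request by blast
    consider "anc (tok u x) ?e" | "anc ?e (tok u x)" | "left (tok u x) ?e" | "left ?e (tok u x)"
      using trichotomy[of "tok u x" ?e] tu(1) by auto
    then show ?thesis
    proof cases
      case 1 then show ?thesis using below_last_tok[OF _ ne] n1 by blast
    next
      case 2 then show ?thesis using request(2) tu(2) anc_trans by auto
    next
      case 3
      \<comment> \<open>This visit at or below the token is after stage \<open>x\<close> and to the
        left of the requesting node, so \<open>x\<close> is too small to be eligible there.\<close>
      obtain v where v: "x < v" "v < u" "anc (tok u x) (last_node v)" using tok_visits(2)[OF tu(1)] by blast
      then have "left (last_node v) ?e" using left_extend1[OF 3] by blast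
      then have "v \<le> x" using v req_elig[OF request(1)] unfolding eligible_def by blast
      then show ?thesis using v(1) by simp
    next
      case 4
      then show ?thesis using left_extend2 tu(2) nl step.hyps(1) by blast
    qed
  next
    case cancel
    then show ?thesis using left_extend2 tu(2) nl step.hyps(1) by blast
  next
    case stay then show ?thesis using tu by simp
  qed
qed

text \<open>The token of the first request is still on the path to the node. It must be at the root,
  as it would otherwise stop the walk or be moved in place of a new request; but then the
  requirement of the node is met.\<close>

lemma req_once:
  assumes "req r x" "req u z" "r < u" "last_node u = last_node r"
    and nl: "\<And>v. r < v \<Longrightarrow> \<not> left (last_node v) (last_node r)"
  shows False
proof -
  have "tok (Suc r) x = last_node r"
    by (cases rule: tok_step_cases[of r x]) (use assms(1) in auto)
  then have "tok u x \<noteq> 0 \<and> anc (tok u x) (last_node r)"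
    using persist[of "Suc r" x "last_node r" u] nl assms(3) by simp
  moreover have "tok u x \<noteq> last_node u" if "1 < last_node u" using req_not_at assms(2) that by blast
  moreover have "1 < last_node u \<or> last_node u = 1" using last_node_pos[of u] by linarith
  ultimately have "tok u x = 1" using below_last_tok[of "tok u x" u] assms(4) by auto
  moreover obtain y where "y < r" "conv {} r (lev (last_node r)) x y"
    using req_elig[OF assms(1)] unfolding eligible_def by blast
  then have "\<exists>y<u. conv {} u (lev (last_node u)) x y"
    using conv_mono assms(3,4) by (metis less_imp_le_nat less_trans)
  moreover have "x < u" using tok_less calculation(1) by simp
  ultimately show False using assms(2) unfolding requests_def wants_def by blast
qed

lemma wants_req: assumes "wants (tok s) last_node s (last_node s)"
    "\<not> (1 < last_node s \<and> (\<exists>z<s. tok s z = last_node s))"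
  shows "\<exists>x. req s x"
proof -
  have "\<exists>x. elig s (last_node s) x" using assms(1) unfolding wants_def by blast
  then have "elig s (last_node s) (LEAST x. elig s (last_node s) x)" by (rule LeastI_ex)
  moreover have "\<forall>y<(LEAST x. elig s (last_node s) x). \<not> elig s (last_node s) y"
    using not_less_Least by blast
  ultimately show ?thesis using assms unfolding requests_def by blast
qed

section \<open>The leftmost path visited infinitely often\<close>

definition visited_inf :: "nat \<Rightarrow> bool" where
  "visited_inf a \<longleftrightarrow> (\<forall>s. \<exists>t\<ge>s. anc a (last_node t))"

text \<open>The right child is a default; \<open>true_path_props\<close> shows that it is visited
  infinitely often whenever it is taken.\<close>

primrec true_path :: "nat \<Rightarrow> nat" where
  "true_path 0 = 1"
| "true_path (Suc n) =
    (if visited_inf (2 * true_path n) then 2 * true_path n else 2 * true_path n + 1)"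

lemma true_path_pos [simp]: "0 < true_path n"
  by (induction n) auto

lemma lev_true_path [simp]: "lev (true_path n) = n"
  by (induction n) auto

lemma anc_true_path: "n \<le> m \<Longrightarrow> anc (true_path n) (true_path m)"
  by (induction m rule: dec_induct) auto

lemma req_finite_of_left_finite:
  assumes "\<And>s. s0 \<le> s \<Longrightarrow> \<not> left (last_node s) a"
  shows "\<exists>s1. \<forall>s\<ge>s1. \<forall>x. req s x \<longrightarrow> last_node s \<noteq> a"
proof (cases "\<exists>r\<ge>s0. \<exists>x. req r x \<and> last_node r = a")
  case True
  then obtain r x where r: "r \<ge> s0" "req r x" "last_node r = a" by blast
  then have "last_node s \<noteq> a" if "Suc r \<le> s" "req s z" for s z
    using req_once[of r x s z] that assms by auto
  then show ?thesis by blast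
next
  case False then show ?thesis by blast
qed

text \<open>If both children were visited only finitely often, every late visit would end at the
  node because of tokens waiting there. One such visit removes them all, and new ones could come
  only from requests, which have ceased, or from visits of a child.\<close>

lemma true_path_props:
  "visited_inf (true_path n) \<and> (\<exists>s0. \<forall>s\<ge>s0. \<not> left (last_node s) (true_path n))"
proof (induction n)
  case 0
  have "visited_inf 1" unfolding visited_inf_def by auto
  moreover have "\<not> left (last_node s) 1" for s using left_not_anc(2)[of "last_node s" 1] by auto
  ultimately show ?case by simp
next
  case (Suc n)
  let ?a = "true_path n"
  obtain s0 where s0: "\<And>s. s0 \<le> s \<Longrightarrow> \<not> left (last_node s) ?a" using Suc by blast
  have inf: "visited_inf ?a" using Suc by blast
  obtain s1 where s1: "\<And>s x. s1 \<le> s \<Longrightarrow> req s x \<Longrightarrow> last_node s \<noteq> ?a"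
    using req_finite_of_left_finite[OF s0] by blast
  have "visited_inf (true_path (Suc n))"
  proof (rule ccontr)
    assume "\<not> visited_inf (true_path (Suc n))"
    then have "\<not> visited_inf (2 * ?a)" "\<not> visited_inf (2 * ?a + 1)"
      by (auto split: if_splits)
    then obtain u v where u: "\<And>s. u \<le> s \<Longrightarrow> \<not> anc (2 * ?a) (last_node s)"
      and v: "\<And>s. v \<le> s \<Longrightarrow> \<not> anc (2 * ?a + 1) (last_node s)"
      unfolding visited_inf_def by blast
    define m where "m = max (max u v) (max s1 (Suc n))"
    have stop: "last_node s = ?a" if "m \<le> s" "anc ?a (last_node s)" for s
      using anc_child[OF that(2)] u[of s] v[of s] that(1) unfolding m_def by auto
    have occupied: "1 < ?a \<and> (\<exists>x. tok s x = ?a)" if s: "m \<le> s" "anc ?a (last_node s)" for s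
    proof -
      have e: "last_node s = ?a" using stop s by blast
      then have "act s ?a" using last_node_stops[of s] s(1) unfolding m_def by simp
      moreover have "\<not> req s x" for x using s1[of s x] e s(1) unfolding m_def by auto
      ultimately show ?thesis using wants_req[of s] e unfolding acts_def by auto
    qed
    obtain s where s: "m \<le> s" "anc ?a (last_node s)" using inf unfolding visited_inf_def by blast
    have empty: "tok t x \<noteq> ?a" if "Suc s \<le> t" for t x
      using that
    proof (induction t rule: dec_induct)
      case base
      have e: "last_node s = ?a" using stop s by blast
      show ?case
      proof (cases rule: tok_step_cases[of s x])
        case request
        then show ?thesis using s1[of s x] e s(1) unfolding m_def by auto
      next
        case stay
        show ?thesis
        proof
          assume "tok (Suc s) x = ?a"
          then have "tok s x = last_node s" "1 < last_node s" using stay e occupied[OF s] by auto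
          then show False using stay tok_step[of s x] by auto
        qed
      qed (use e in auto)
    next
      case (step t)
      then have t: "m \<le> t" using s(1) by simp
      show ?case
      proof (cases rule: tok_step_cases[of t x])
        case move
        show ?thesis
        proof
          assume "tok (Suc t) x = ?a"
          then have "anc ?a (last_node t)" "last_node t \<noteq> ?a"
            using move anc_div2[of "last_node t"] by auto
          then show False using stop[OF t] by simp
        qed
      next
        case request
        then show ?thesis using s1[of t x] t unfolding m_def by auto
      qed (use step in auto)
    qed
    obtain t where "Suc s \<le> t" "anc ?a (last_node t)" using inf unfolding visited_inf_def by blast
    then show False using occupied[of t] empty[of t] s(1) by auto
  qed
  moreover have "\<exists>s0. \<forall>s\<ge>s0. \<not> left (last_node s) (true_path (Suc n))"
  proof -
    obtain u where u: "visited_inf (2 * ?a) \<or> (\<forall>s\<ge>u. \<not> anc (2 * ?a) (last_node s))"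
      unfolding visited_inf_def by blast
    have "\<not> left (last_node s) (true_path (Suc n))" if s: "s0 \<le> s" "u \<le> s" for s
    proof
      let ?b = "true_path (Suc n)"
      assume l: "left (last_node s) ?b"
      have ab: "anc ?a ?b" using anc_true_path[of n "Suc n"] by simp
      have "anc ?a (last_node s)" using left_prefix2[OF l ab] s0 s(1) by blast
      moreover have "?a \<noteq> last_node s" using left_not_anc(1)[OF l] ab by metis
      ultimately consider "anc (2 * ?a) (last_node s)" | "anc (2 * ?a + 1) (last_node s)"
        using anc_child by blast
      then show False
      proof cases
        case 1
        then have "?b = 2 * ?a" using u s(2) by auto
        then show False using 1 left_not_anc(2)[OF l] by simp
      next
        case 2
        show False
        proof (cases "visited_inf (2 * ?a)")
          case True
          then have "left ?b (last_node s)" using 2 unfolding left_iff by (intro exI[of _ ?a]) simp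
          then show False using left_asym l by blast
        next
          case False
          then show False using 2 left_not_anc(2)[OF l] by simp
        qed
      qed
    qed
    then show ?thesis by (intro exI[of _ "max s0 u"]) auto
  qed
  ultimately show ?case by blast
qed

text \<open>A visit of the next node on the path passes this one, which therefore does not
  act.\<close>

lemma pass_true_path: "\<exists>t\<ge>s. anc (true_path n) (last_node t) \<and> true_path n \<noteq> last_node t"
proof -
  obtain t where t: "s \<le> t" "anc (true_path (Suc n)) (last_node t)"
    using true_path_props[of "Suc n"] unfolding visited_inf_def by blast
  have "anc (true_path n) (last_node t)" using anc_true_path[of n "Suc n"] t(2) anc_trans by auto
  moreover have "Suc n \<le> lev (last_node t)" using lev_anc[OF t(2)] by (simp only: lev_true_path)
  then have "true_path n \<noteq> last_node t" using lev_true_path Suc_n_not_le_n by metis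
  ultimately show ?thesis using t(1) by blast
qed

lemma left_finite: "\<exists>s0. \<forall>s\<ge>s0. \<not> left (last_node s) (true_path n)"
  using true_path_props by blast

lemma req_finite: "\<exists>s1. \<forall>s\<ge>s1. \<forall>x. req s x \<longrightarrow> last_node s \<noteq> true_path n"
  using left_finite[of n] req_finite_of_left_finite by blast

lemma req_finite_below: "\<exists>s1. \<forall>s\<ge>s1. \<forall>k<n. \<forall>x. req s x \<longrightarrow> last_node s \<noteq> true_path k"
  by (rule eventually_bounded) (rule req_finite)

lemma simp_set_settles: "\<exists>s0. \<forall>s\<ge>s0. \<forall>z<u. z \<in> simp_set \<longleftrightarrow> tok s z = 1"
proof (rule eventually_bounded)
  fix z
  show "\<exists>s0. \<forall>s\<ge>s0. z \<in> simp_set \<longleftrightarrow> tok s z = 1"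
  proof (cases "z \<in> simp_set")
    case True
    then obtain s where "tok s z = 1" unfolding simp_set_def by blast
    then show ?thesis using True tok_1_mono by blast
  next
    case False
    then show ?thesis unfolding simp_set_def by blast
  qed
qed

lemma computation_settles:
  assumes "computes simp_set e m y"
  obtains u where "\<And>s. u \<le> s \<Longrightarrow> conv {x. tok s x = 1} u e m y"
proof -
  obtain u where u: "conv simp_set u e m y" using computes_conv[OF assms] by blast
  obtain s0 where s0: "\<forall>s\<ge>s0. \<forall>z<u. z \<in> simp_set \<longleftrightarrow> tok s z = 1" using simp_set_settles by blast
  have "conv {x. tok s x = 1} (max u s0) e m y" if "max u s0 \<le> s" for s
    using conv_mono[OF conv_local[OF u]] s0 that by auto
  then show ?thesis using that by blast
qed

text \<open>If the left child were visited only before stage \<open>R\<close>, the guess would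
  depend on arguments below \<open>R\<close> alone; these computations settle, and the next pass
  would turn left.\<close>

lemma total_imp_left:
  assumes tot: "\<And>m. \<exists>y. computes simp_set n m y"
  shows "true_path (Suc n) = 2 * true_path n"
proof (rule ccontr)
  let ?a = "true_path n"
  assume ne: "true_path (Suc n) \<noteq> 2 * ?a"
  then have "\<not> visited_inf (2 * ?a)" by auto
  then obtain R where R: "\<And>s. R \<le> s \<Longrightarrow> \<not> anc (2 * ?a) (last_node s)"
    unfolding visited_inf_def by blast
  have "\<exists>s1. \<forall>s\<ge>s1. \<forall>m<R. \<exists>y<s. conv {x. tok s x = 1} s n m y"
  proof (rule eventually_bounded)
    fix m
    obtain y where "computes simp_set n m y" using tot by blast
    then obtain u where u: "\<And>s. u \<le> s \<Longrightarrow> conv {x. tok s x = 1} u n m y"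
      using computation_settles by blast
    have "\<exists>y<s. conv {x. tok s x = 1} s n m y" if "u \<le> s" for s
      using conv_mono[OF u[OF that] that] conv_less(2) by blast
    then show "\<exists>u. \<forall>s\<ge>u. \<exists>y<s. conv {x. tok s x = 1} s n m y" by blast
  qed
  then obtain s1 where s1: "\<forall>s\<ge>s1. \<forall>m<R. \<exists>y<s. conv {x. tok s x = 1} s n m y" by blast
  have g: "guess s ?a" if "s1 \<le> s" for s
    unfolding total_guess_def
  proof (intro allI impI)
    fix r m assume "r < s" "anc (2 * ?a) (last_node r)" "m \<le> r"
    then have "m < R" using R[of r] by (meson le_less_trans not_less)
    then show "\<exists>y<s. conv {x. tok s x = 1} s (lev ?a) m y" using s1 that by simp
  qed
  obtain t where t: "max s1 R \<le> t" "anc ?a (last_node t)" "?a \<noteq> last_node t"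
    using pass_true_path by blast
  then have "anc (2 * ?a) (last_node t)" using below_last(2)[OF t(2,3)] g by simp
  then show False using R t(1) by simp
qed

subsection \<open>Restraint, simplicity and the complement\<close>

lemma anc_true_path_eq: assumes "anc a (true_path m)" shows "a = true_path (lev a)"
proof -
  have l: "lev a \<le> m" using lev_anc[OF assms] by simp
  have "anc a (true_path (lev a))" using anc_by_lev[OF assms anc_true_path[OF l]] by simp
  then show ?thesis using lev_anc_eq by simp
qed

lemma first_change:
  assumes "t \<le> t'" "z < u" "tok t' z = 1" "tok t z \<noteq> 1"
  obtains t1 z1 where "t \<le> t1" "t1 < t'" "z1 < u" "tok (Suc t1) z1 = 1" "tok t1 z1 \<noteq> 1"
    "\<And>v z. t \<le> v \<Longrightarrow> v \<le> t1 \<Longrightarrow> z < u \<Longrightarrow> tok v z = 1 \<longleftrightarrow> tok t z = 1"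
proof -
  define Q where "Q v \<longleftrightarrow> t \<le> v \<and> (\<exists>z<u. tok v z = 1 \<and> tok t z \<noteq> 1)" for v
  have Q: "Q t'" unfolding Q_def using assms by blast
  define w where "w = (LEAST v. Q v)"
  have w: "Q w" "w \<le> t'" "\<And>v. v < w \<Longrightarrow> \<not> Q v"
    unfolding w_def using LeastI[of Q, OF Q] Least_le[of Q, OF Q] not_less_Least by blast+
  have "w \<noteq> t" using w(1) unfolding Q_def by blast
  moreover have "t \<le> w" using w(1) unfolding Q_def by blast
  ultimately obtain t1 where t1: "w = Suc t1" "t \<le> t1" by (cases w) auto
  obtain z1 where z1: "z1 < u" "tok w z1 = 1" "tok t z1 \<noteq> 1" using w(1) unfolding Q_def by blast
  have const: "tok v z = 1 \<longleftrightarrow> tok t z = 1" if "t \<le> v" "v \<le> t1" "z < u" for v z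
    using w(3)[of v] t1 that tok_1_mono[of t z v] unfolding Q_def by auto
  have "t1 < t'" "tok (Suc t1) z1 = 1" using w(2) t1(1) z1(2) by auto
  moreover have "tok t1 z1 \<noteq> 1" using const[OF t1(2) order.refl z1(1)] z1(3) by blast
  ultimately show ?thesis using that t1(2) z1(1) const by blast
qed

text \<open>
  Only numbers requested below \<open>b\<close> matter, and at the time of the request they exceed the use of
  the computation that then exists. So a number that destroys the computation at \<open>T\<close> was requested
  earlier, at some \<open>r\<close>, and the computation existing at \<open>r\<close> has in turn been destroyed before \<open>T\<close> by
  a still older token. This is impossible: tokens present at \<open>r\<close> and not cancelled then occupy
  nodes below or to the left of the requesting node, so they cannot move before the new token has
  reached the root or has been cancelled.
\<close>

lemma left_imp_total:
  assumes lft: "true_path (Suc n) = 2 * true_path n"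
  shows "\<exists>y. computes simp_set n m y"
proof -
  define a where "a = true_path n"
  \<comment> \<open>\<open>L > n\<close> puts \<open>b\<close> at or below the left child of
    \<open>a\<close>, and \<open>L \<ge> m\<close> makes the nodes at or below \<open>b\<close>
    protect the value at \<open>m\<close>.\<close>
  define L where "L = max (Suc n) m"
  define b where "b = true_path L"
  define P where "P s u \<longleftrightarrow> (\<exists>y<u. conv {x. tok s x = 1} u n m y)" for s u
  have ab: "anc (2 * a) b"
    unfolding a_def b_def lft[symmetric] by (rule anc_true_path) (simp add: L_def)
  obtain q0 q1 where q0: "\<And>s. q0 \<le> s \<Longrightarrow> \<not> left (last_node s) b"
    and q1: "\<And>s x k. q1 \<le> s \<Longrightarrow> req s x \<Longrightarrow> k < L \<Longrightarrow> last_node s \<noteq> true_path k"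
    using left_finite[of L] req_finite_below[of L] unfolding b_def by metis
  define q where "q = max q0 q1"
  \<comment> \<open>Late visits do not go to the left of \<open>b\<close>, and the nodes above
    \<open>b\<close> have made their last requests.\<close>
  have req_cases: "anc b (last_node s) \<or> left b (last_node s)" if "q \<le> s" "req s x" for s x
  proof -
    have "\<not> left (last_node s) b" using q0 that unfolding q_def by simp
    moreover have "last_node s = b" if "anc (last_node s) b"
    proof -
      have eq: "last_node s = true_path (lev (last_node s))"
        using anc_true_path_eq that unfolding b_def by blast
      moreover have "lev (last_node s) \<le> L" using lev_anc[OF that] unfolding b_def by simp
      moreover have "\<not> lev (last_node s) < L"
        using q1[of s x] eq \<open>q \<le> s\<close> \<open>req s x\<close> unfolding q_def by auto
      ultimately show ?thesis unfolding b_def by simp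
    qed
    moreover have "0 < b" unfolding b_def by simp
    ultimately show ?thesis using trichotomy[of b "last_node s"] by auto
  qed
  have P_cong: "P s u \<Longrightarrow> P t u" if "\<And>z. z < u \<Longrightarrow> tok s z = 1 \<longleftrightarrow> tok t z = 1" for s t u
    unfolding P_def using conv_local[of "{x. tok s x = 1}" u n m _ "{x. tok t x = 1}"] that by auto
  have req_P: "P s x" if "req s x" "anc b (last_node s)" for s x
  proof -
    have "anc (2 * a) (last_node s)" using ab that(2) anc_trans by blast
    moreover have "a \<le> last_node s" using anc_le[OF calculation] by simp
    moreover have "m \<le> lev (last_node s)" using lev_anc[OF that(2)] unfolding b_def L_def by simp
    ultimately show ?thesis
      using req_elig[OF that(1)] unfolding eligible_def P_def a_def by (metis lev_true_path)
  qed
  \<comment> \<open>Requests made from \<open>t\<close> on at or below \<open>b\<close> respect the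
    least bound \<open>u\<close>, and those to the right of \<open>b\<close> concern numbers at
    least \<open>t\<close>; so a number below \<open>u\<close> was requested earlier.\<close>
  have old: "r < t"
    if t: "q \<le> t" "anc b (last_node t)" and u: "u \<le> t" "\<And>v. v < u \<Longrightarrow> \<not> P t v"
      and const: "\<And>v z. t \<le> v \<Longrightarrow> v \<le> t1 \<Longrightarrow> z < u \<Longrightarrow> tok v z = 1 \<longleftrightarrow> tok t z = 1"
      and z: "z < u" "req r z" "r \<le> t1" for t u t1 z r
  proof (rule ccontr)
    assume "\<not> r < t"
    then have tr: "t \<le> r" by simp
    have "\<not> P r z"
      using P_cong[of z r t] const[OF tr z(3)] u(2)[OF z(1)] z(1) by auto
    then have "left b (last_node r)" using req_cases[of r z] req_P z(2) t(1) tr by auto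
    then have "left (last_node t) (last_node r)" using left_extend1 t(2) by blast
    moreover have "t < r" using tr calculation by (metis left_irrefl le_neq_implies_less)
    ultimately have "t \<le> z" using req_elig[OF z(2)] unfolding eligible_def by blast
    then show False using z(1) u(1) by simp
  qed
  \<comment> \<open>This visit of the left child obliges the guess at the later stage
    \<open>T\<close> to check the argument \<open>m\<close>.\<close>
  obtain r0 where r0: "m \<le> r0" "anc (2 * a) (last_node r0)"
    using true_path_props[of "Suc n"] lft unfolding visited_inf_def a_def by auto
  \<comment> \<open>Numbers below \<open>s1\<close> will have settled by \<open>s2\<close>, and all
    others can be requested only after \<open>s1\<close>.\<close>
  obtain s1 where s1: "max q (Suc r0) \<le> s1" "anc b (last_node s1)"
    using pass_true_path[of "max q (Suc r0)" L] unfolding b_def by blast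
  obtain s2 where s2: "\<forall>s\<ge>s2. \<forall>z<s1. z \<in> simp_set \<longleftrightarrow> tok s z = 1"
    using simp_set_settles by blast
  obtain T where T: "max s1 s2 \<le> T" "anc b (last_node T)" "b \<noteq> last_node T"
    using pass_true_path[of "max s1 s2" L] unfolding b_def by blast
  have anca: "anc a b" using anc_true_path[of n L] unfolding a_def b_def L_def by simp
  have "P T T"
  proof -
    have "anc a (last_node T)" "a \<noteq> last_node T"
      using anca T(2,3) anc_trans anc_antisym by blast+
    moreover have "anc (2 * a) (last_node T)" using ab T(2) anc_trans by blast
    ultimately have "guess T a" using below_last(2) by blast
    moreover have "r0 < T" using s1(1) T(1) by simp
    ultimately show ?thesis unfolding total_guess_def P_def using r0 unfolding a_def by auto
  qed
  define u where "u = (LEAST u. P T u)"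
  have u: "P T u" "u \<le> T" "\<And>v. v < u \<Longrightarrow> \<not> P T v"
    unfolding u_def using LeastI[of "P T", OF \<open>P T T\<close>] Least_le[of "P T", OF \<open>P T T\<close>] not_less_Least
    by blast+
  have stable: "z \<in> simp_set \<longleftrightarrow> tok T z = 1" if "z < u" for z
  proof (rule ccontr)
    assume "\<not> (z \<in> simp_set \<longleftrightarrow> tok T z = 1)"
    then have "z \<in> simp_set" "tok T z \<noteq> 1" unfolding simp_set_def by auto
    then obtain s where "tok s z = 1" unfolding simp_set_def by blast
    then have "tok (max s T) z = 1" using tok_1_mono by simp
    then obtain t' where "tok t' z = 1" "T \<le> t'" by (meson max.cobounded2)
    \<comment> \<open>\<open>z1\<close> is a first number below \<open>u\<close> to enter after
      \<open>T\<close>; its request at \<open>r\<close> turns out to precede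
      \<open>T\<close>.\<close>
    from first_change[OF this(2) that this(1) \<open>tok T z \<noteq> 1\<close>]
    obtain t1 z1 where t1: "T \<le> t1" "z1 < u" "tok (Suc t1) z1 = 1" "tok t1 z1 \<noteq> 1"
      and const1: "\<And>v z. T \<le> v \<Longrightarrow> v \<le> t1 \<Longrightarrow> z < u \<Longrightarrow> tok v z = 1 \<longleftrightarrow> tok T z = 1"
      by metis
    obtain r where r: "r \<le> t1" "req r z1" "\<And>v. r < v \<Longrightarrow> v \<le> t1 \<Longrightarrow> \<not> req v z1"
      and alive: "\<And>v. r < v \<Longrightarrow> v \<le> Suc t1 \<Longrightarrow> tok v z1 \<noteq> 0 \<and> anc (tok v z1) (last_node r)"
      using origin[of "Suc t1" z1] t1(3) by (auto simp: less_Suc_eq_le)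
    have not1: "tok v z1 \<noteq> 1" if "v \<le> t1" for v using t1(4) tok_1_mono that by blast
    have qT: "q \<le> T" using s1(1) T(1) by simp
    have rT: "r < T"
      by (rule old[OF qT T(2) u(2,3) const1 t1(2) r(2,1)])
    have "z1 \<in> simp_set" "tok T z1 \<noteq> 1" "s2 \<le> T"
      using t1(3) not1[OF t1(1)] T(1) unfolding simp_set_def by auto
    then have "\<not> z1 < s1" using s2 by blast
    then have "s1 \<le> z1" by simp
    then have qr: "q \<le> r" using req_less[OF r(2)] s1(1) by simp
    \<comment> \<open>A token on the path to \<open>b\<close> would have to be at the root, since
      the walk at \<open>T\<close> passes beyond \<open>b\<close>.\<close>
    have bT: "anc (tok T z1) b \<Longrightarrow> False"
    proof -
      assume h: "anc (tok T z1) b"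
      have "anc (tok T z1) (last_node T)" by (rule anc_trans[OF h T(2)])
      moreover have "tok T z1 \<noteq> last_node T" using anc_antisym[OF h] T(2,3) by metis
      ultimately show False using below_last_tok not1[OF t1(1)] by blast
    qed
    \<comment> \<open>A token to the right of \<open>b\<close> would be cancelled by the visit at
      \<open>T\<close>.\<close>
    have b_r: "anc b (last_node r)"
    proof (rule ccontr)
      assume "\<not> anc b (last_node r)"
      then have "left b (last_node r)" using req_cases[OF qr r(2)] by blast
      then have "left b (tok T z1)"
        using left_prefix2 alive[of T] rT t1(1) bT by (metis le_SucI)
      then have "left (last_node T) (tok T z1)" using left_extend1 T(2) by blast
      then have "tok (Suc T) z1 = 0"
        using r(3)[OF rT t1(1)] tok_step[of T z1] by auto
      then show False using alive[of "Suc T"] rT t1(1) by simp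
    qed
    have "P r z1" using req_P[OF r(2) b_r] .
    define w where "w = (LEAST u. P r u)"
    have w: "P r w" "w \<le> z1" "\<And>v. v < w \<Longrightarrow> \<not> P r v"
      unfolding w_def using LeastI[of "P r", OF \<open>P r z1\<close>] Least_le[of "P r", OF \<open>P r z1\<close>] not_less_Least
      by blast+
    \<comment> \<open>Since \<open>w \<le> z1 < u\<close>, survival of the computation from
      \<open>r\<close> to \<open>T\<close> would contradict the minimality of
      \<open>u\<close>.\<close>
    have "\<not> (\<forall>z<w. tok r z = 1 \<longleftrightarrow> tok T z = 1)"
      using P_cong[of w r T] w(1,2) u(3)[of w] t1(2) by auto
    then obtain z where z: "z < w" "tok T z = 1" "tok r z \<noteq> 1"
      using tok_1_mono rT less_imp_le_nat by metis
    from first_change[OF less_imp_le_nat[OF rT] this]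
    obtain t2 z2 where t2: "r \<le> t2" "t2 < T" "z2 < w" "tok (Suc t2) z2 = 1" "tok t2 z2 \<noteq> 1"
      and const2: "\<And>v z. r \<le> v \<Longrightarrow> v \<le> t2 \<Longrightarrow> z < w \<Longrightarrow> tok v z = 1 \<longleftrightarrow> tok r z = 1"
      by metis
    obtain r2 where r2: "r2 \<le> t2" "req r2 z2" "\<And>v. r2 < v \<Longrightarrow> v \<le> t2 \<Longrightarrow> \<not> req v z2"
      and alive2: "\<And>v. r2 < v \<Longrightarrow> v \<le> Suc t2 \<Longrightarrow> tok v z2 \<noteq> 0 \<and> anc (tok v z2) (last_node r2)"
      using origin[of "Suc t2" z2] t2(4) by (auto simp: less_Suc_eq_le)
    have wr: "w \<le> r" using w(2) req_less[OF r(2)] by simp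
    have r2r: "r2 < r"
      by (rule old[OF qr b_r wr w(3) const2 t2(3) r2(2,1)])
    \<comment> \<open>The position of the older token of \<open>z2\<close> when \<open>z1\<close> is
      requested. That visit neither passes nor cancels it, so it lies below or to the left of the
      requesting node.\<close>
    define h where "h = tok r z2"
    have h: "h \<noteq> 0" "h \<noteq> 1" "h \<noteq> last_node r" "\<not> req r z2"
    proof -
      show "h \<noteq> 0" using alive2[of r] r2r t2(1) unfolding h_def by simp
      show "h \<noteq> 1" using t2(1,5) tok_1_mono unfolding h_def by blast
      show "\<not> req r z2" using r2(3) r2r t2(1) by blast
      show "h \<noteq> last_node r"
        using req_not_at[OF r(2), of z2] \<open>h \<noteq> 1\<close> last_node_pos[of r] unfolding h_def
        by (metis One_nat_def Suc_lessI)
    qed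
    have h_left: "\<not> left (last_node r) h"
      using tok_step[of r z2] h alive2[of "Suc r"] r2r t2(1) unfolding h_def by auto
    have h_stay: "tok (Suc r) z2 = h"
      using tok_step[of r z2] h h_left unfolding h_def by simp
    have "\<not> anc h (last_node r)" using below_last_tok[of h r z2] h unfolding h_def by blast
    then have h_pos: "anc (last_node r) h \<or> left h (last_node r)"
      using trichotomy[of h "last_node r"] h(1) h_left by auto
    \<comment> \<open>The number \<open>z2\<close> has entered by stage \<open>T\<close>, so its
      token must leave \<open>h\<close>, which takes a visit ending at \<open>h\<close>.\<close>
    obtain v where v: "r < v" "v \<le> t2" "last_node v = h"
    proof -
      define Q where "Q v \<longleftrightarrow> Suc r \<le> v \<and> tok v z2 \<noteq> h" for v
      have Q: "Q (Suc t2)" unfolding Q_def using t2(1,4) h(2) by simp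
      define k where "k = (LEAST v. Q v)"
      have k: "Q k" "k \<le> Suc t2" "\<And>v. v < k \<Longrightarrow> \<not> Q v"
        unfolding k_def using LeastI[of Q, OF Q] Least_le[of Q, OF Q] not_less_Least by blast+
      have "k \<noteq> Suc r" using k(1) h_stay unfolding Q_def by blast
      then obtain v where kv: "k = Suc v" "Suc r \<le> v" using k(1) unfolding Q_def
        by (cases k) auto
      have tv: "tok v z2 = h" "tok (Suc v) z2 \<noteq> h" using k(3)[of v] k(1) kv unfolding Q_def by auto
      have v_le: "v \<le> t2" using k(2) kv(1) by simp
      have "last_node v = h"
        using tok_step_cases[of v z2] tv alive2[of "Suc v"] r2(3)[of v] r2r kv(2) v_le
        by (metis Suc_le_lessD Suc_le_mono less_SucI less_trans)
      then show ?thesis using that[of v] kv(2) v_le by simp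
    qed
    define th where "th = tok v z1"
    have v1: "v \<le> t1" using v(2) t2(2) t1(1) by simp
    have th: "th \<noteq> 0" "anc th (last_node r)" "th \<noteq> 1" "\<not> req v z1"
      using alive[of v] v(1) v1 not1[OF v1] r(3)[OF v(1) v1] unfolding th_def by auto
    \<comment> \<open>At stage \<open>v\<close> the token of \<open>z1\<close> is on the path to its
      requesting node; it would either stop the walk before \<open>h\<close> or be cancelled by the
      visit of \<open>h\<close>.\<close>
    have "\<not> (anc th h \<and> th \<noteq> h)"
      using below_last_tok[of th v z1] v(3) th(3) unfolding th_def by blast
    moreover have "\<not> left h th"
    proof
      assume "left h th"
      then have "tok (Suc v) z1 = 0"
        using tok_step[of v z1] v(3) th(4) unfolding th_def by auto
      then show False using alive[of "Suc v"] v(1) v1 by simp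
    qed
    ultimately show False
      using h_pos th(2) h(3) left_prefix2[of h "last_node r" th] anc_trans[of th "last_node r" h]
        anc_antisym[of h "last_node r"] left_not_anc[of h "last_node r"] by blast
  qed
  obtain y where "conv {x. tok T x = 1} u n m y" using u(1) unfolding P_def by blast
  then have "conv simp_set u n m y"
    by (rule conv_local) (use stable in auto)
  then show ?thesis using conv_computes by blast
qed

section \<open>Simplicity\<close>

text \<open>Otherwise the node of level \<open>e\<close> on the true path would want some large
  element of \<open>W e\<close> at a stage at which it is passed. The functions guessed total above
  it are total, so the computations that \<open>x\<close> has to exceed settle.\<close>

lemma simp_set_meets:
  assumes inf: "infinite (W e)"
  shows "simp_set \<inter> W e \<noteq> {}"
proof
  assume disj: "simp_set \<inter> W e = {}"
  define a where "a = true_path e"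
  obtain s0 where s0: "\<And>s. s0 \<le> s \<Longrightarrow> \<not> left (last_node s) a"
    using left_finite[of e] unfolding a_def by blast
  have "\<exists>u. \<forall>v\<ge>u. anc (2 * c) a \<longrightarrow> (\<forall>s\<ge>v. \<exists>y<v. conv {x. tok s x = 1} v (lev c) m y)" for c m
  proof (cases "anc (2 * c) a")
    case True
    have c: "anc c a" using anc_parent(1)[OF True] .
    then have "c = true_path (lev c)" using anc_true_path_eq unfolding a_def by blast
    moreover have "2 * c = true_path (lev (2 * c))"
      using anc_true_path_eq True unfolding a_def by blast
    ultimately have "true_path (Suc (lev c)) = 2 * true_path (lev c)" using anc_pos[OF c] by simp
    then obtain y where "computes simp_set (lev c) m y" using left_imp_total by blast
    then obtain u where "\<And>s. u \<le> s \<Longrightarrow> conv {x. tok s x = 1} u (lev c) m y"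
      using computation_settles by blast
    then have "\<forall>v\<ge>u. \<forall>s\<ge>v. conv {x. tok s x = 1} v (lev c) m y"
      using conv_mono by (meson order_trans)
    then show ?thesis using conv_less(2) by blast
  qed simp
  then have "\<exists>u. \<forall>v\<ge>u. \<forall>c<Suc a. \<forall>m<Suc e. anc (2 * c) a \<longrightarrow>
      (\<forall>s\<ge>v. \<exists>y<v. conv {x. tok s x = 1} v (lev c) m y)"
    by (intro eventually_bounded[where k = "Suc a"] eventually_bounded[where k = "Suc e"])
  then obtain u where u: "\<And>v c m s. u \<le> v \<Longrightarrow> c \<le> a \<Longrightarrow> m \<le> e \<Longrightarrow> anc (2 * c) a \<Longrightarrow> v \<le> s \<Longrightarrow>
      \<exists>y<v. conv {x. tok s x = 1} v (lev c) m y"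
    by (metis less_Suc_eq_le)
  \<comment> \<open>Large enough for the clauses of eligibility: \<open>2 * a\<close>, the stages of
    visits to the left, and the settled uses.\<close>
  obtain x where x: "x \<in> W e" "max (2 * a) (max s0 u) \<le> x"
  proof -
    have "\<not> W e \<subseteq> {..<max (2 * a) (max s0 u)}" using inf finite_subset by blast
    then show ?thesis using that by (meson lessThan_iff not_le subsetI)
  qed
  obtain y where "computes {} e x y" using x(1) unfolding W_def by blast
  then obtain v where v: "conv {} v e x y" using computes_conv by blast
  obtain t where t: "max v (Suc x) \<le> t" "anc a (last_node t)" "a \<noteq> last_node t"
    using pass_true_path unfolding a_def by blast
  have la: "lev a = e" unfolding a_def by simp
  have "conv {} t e x y" using conv_mono[OF v] t(1) by simp
  then have xt: "\<exists>y<t. conv {} t (lev a) x y" using conv_less(2) la by blast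
  have "r \<le> x" if "left (last_node r) a" for r
    using s0[of r] that x(2) by (meson le_cases le_trans max.bounded_iff)
  then have "elig t a x"
    unfolding eligible_def using xt x(2) u[of x] t(1) la by auto
  moreover have "tok t z \<noteq> 1" if "\<exists>y<t. conv {} t (lev a) z y" for z
    using disj that conv_computes la unfolding W_def simp_set_def by blast
  ultimately have "wants (tok t) last_node t a"
    unfolding wants_def using elig_less by blast
  then show False using below_last(1)[OF t(2,3)] unfolding acts_def by blast
qed

text \<open>Elements of \<open>simp_set\<close> stem from different requesting nodes, and a node
  \<open>a\<close> contributes only numbers at least \<open>2 * a\<close>; thus fewer than
  \<open>N\<close> elements lie below \<open>2 * N\<close>.\<close>

lemma infinite_complement: "infinite (- simp_set)"
proof
  assume fin: "finite (- simp_set)"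
  have "\<exists>r. req r x \<and> (\<forall>v>r. tok v x \<noteq> 0 \<and> anc (tok v x) (last_node r))" if x: "x \<in> simp_set" for x
  proof -
    obtain t where t: "tok t x = 1" using x unfolding simp_set_def by blast
    obtain r where r: "r < t" "req r x"
      "\<forall>v. r < v \<and> v \<le> t \<longrightarrow> tok v x \<noteq> 0 \<and> anc (tok v x) (last_node r) \<and> anc (tok t x) (tok v x)"
      using origin[of t x] t by auto
    have "tok v x \<noteq> 0 \<and> anc (tok v x) (last_node r)" if "r < v" for v
    proof (cases "v \<le> t")
      case True then show ?thesis using r that by blast
    next
      case False then show ?thesis using tok_1_mono[OF t, of v] by simp
    qed
    then show ?thesis using r(2) by blast
  qed
  then obtain R where R: "\<And>x. x \<in> simp_set \<Longrightarrow> req (R x) x"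
    "\<And>x v. x \<in> simp_set \<Longrightarrow> R x < v \<Longrightarrow> tok v x \<noteq> 0 \<and> anc (tok v x) (last_node (R x))"
    by metis
  \<comment> \<open>As in \<open>req_once\<close>: at the second request of the same node the first
    token is at the root, and the requirement is already met.\<close>
  have later: False
    if x: "x \<in> simp_set" "y \<in> simp_set" "R x < R y" "last_node (R x) = last_node (R y)" for x y
  proof -
    let ?u = "R y"
    have tk: "anc (tok ?u x) (last_node ?u)" using R(2)[OF x(1,3)] x(4) by simp
    have "tok ?u x \<noteq> last_node ?u" if "1 < last_node ?u" using req_not_at[OF R(1)[OF x(2)] that] .
    moreover have "1 < last_node ?u \<or> last_node ?u = 1" using last_node_pos[of ?u] by linarith
    ultimately have t1: "tok ?u x = 1" using below_last_tok[OF tk] tk by auto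
    obtain z where "z < R x" "conv {} (R x) (lev (last_node (R x))) x z"
      using req_elig[OF R(1)[OF x(1)]] unfolding eligible_def by blast
    then have "\<exists>z<?u. conv {} ?u (lev (last_node ?u)) x z"
      using conv_mono x(3,4) by (metis less_imp_le_nat less_trans)
    moreover have "x < ?u" using tok_less t1 by simp
    ultimately show False using R(1)[OF x(2)] t1 unfolding requests_def wants_def by blast
  qed
  have inj: "inj_on (\<lambda>x. last_node (R x)) simp_set"
  proof (rule inj_onI)
    fix x y assume xy: "x \<in> simp_set" "y \<in> simp_set" "last_node (R x) = last_node (R y)"
    then have "R x = R y" using later[of x y] later[of y x] by (metis linorder_neqE_nat)
    then show "x = y" using req_unique R(1) xy(1,2) by metis
  qed
  \<comment> \<open>The \<open>2 * N = 2 * k + 2\<close> numbers below \<open>2 * N\<close> would be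
    covered by at most \<open>k\<close> elements of the set and \<open>k\<close> of the
    complement.\<close>
  define k where "k = card (- simp_set)"
  define N where "N = Suc k"
  have "(\<lambda>x. last_node (R x)) ` (simp_set \<inter> {..<2 * N}) \<subseteq> {1..<N}"
  proof (clarsimp)
    fix x assume x: "x \<in> simp_set" "x < 2 * N"
    then have "2 * last_node (R x) \<le> x" using req_elig[OF R(1)] unfolding eligible_def by blast
    then show "Suc 0 \<le> last_node (R x) \<and> last_node (R x) < N"
      using x(2) last_node_pos[of "R x"] by linarith
  qed
  then have "card (simp_set \<inter> {..<2 * N}) \<le> card {1..<N}"
    using card_inj_on_le[OF inj_on_subset[OF inj]] by (metis Int_lower1 finite_atLeastLessThan)
  then have 1: "card (simp_set \<inter> {..<2 * N}) \<le> k" unfolding N_def by simp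
  have "card {..<2 * N} \<le> card (simp_set \<inter> {..<2 * N}) + card (- simp_set)"
    by (rule order.trans[OF card_mono card_Un_le]) (use fin in auto)
  then show False using 1 unfolding N_def k_def by simp
qed

subsection \<open>Two-tardiness and lowness\<close>

lemma ce_simp_set: "ce simp_set"
  unfolding simp_set_def by (rule ce_Collect_ex) (intro rec_intros)

lemma simple_simp_set: "simple_set simp_set"
  unfolding simple_set_def using ce_simp_set infinite_complement simp_set_meets unfolding ce_def by blast

text \<open>Stage \<open>s\<close> contains only numbers below \<open>s\<close>, so its canonical
  index is a bounded sum.\<close>

lemma computable_enumeration_tok: "computable_enumeration (\<lambda>s. {x. tok s x = 1}) simp_set"
proof -
  have sub: "{x. tok s x = 1} \<subseteq> {..<s}" for s using tok_less by fastforce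
  have fin: "finite {x. tok s x = 1}" for s using sub finite_subset by blast
  have "set_encode {x. tok s x = 1} = (\<Sum>x<s. if tok s x = 1 then 2 ^ x else 0)" for s
  proof -
    have "(\<Sum>x<s. if tok s x = 1 then 2 ^ x else 0) = (\<Sum>x\<in>{x \<in> {..<s}. tok s x = 1}. 2 ^ x :: nat)"
      by (rule sum.inter_filter[symmetric]) simp
    moreover have "{x \<in> {..<s}. tok s x = 1} = {x. tok s x = 1}" using sub by blast
    ultimately show ?thesis unfolding set_encode_def by simp
  qed
  moreover have "rec_in {} (\<lambda>s. \<Sum>x<s. if tok s x = 1 then 2 ^ x else 0)"
    by (intro rec_sum_less rec_intros)
  ultimately have "computable_fun (\<lambda>s. set_encode {x. tok s x = 1})"
    unfolding computable_fun_iff_rec_in by simp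
  then show ?thesis
    unfolding computable_enumeration_def mono_def simp_set_def using fin tok_1_mono by blast
qed

text \<open>
  The 2-c.e. complement of \<open>A\<close> is \<open>W i - W j\<close>: a number enters \<open>W i\<close> at a visit of the node \<open>2 * a\<close>
  on the true path, and \<open>W j\<close> when its token reaches this node or one of its ancestors. Numbers
  below \<open>b\<close> are treated separately.
\<close>

lemma two_tardy_simp_set: "two_tardy simp_set"
proof -
  define P where "P k x t \<longleftrightarrow> p2 k \<le> x \<and> tok t x \<noteq> 0 \<and> anc (tok t x) (p1 k)" for k x t
  have "dec_in {} (\<lambda>z. P (p1 z) (p1 (p2 z)) (p2 (p2 z)))"
    unfolding P_def by (intro rec_intros)
  from param_search_index[OF this] obtain c
    where "\<And>k x. (\<exists>y. computes {} (smn c k) x y) \<longleftrightarrow> (\<exists>t. P k x t)" by blast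
  then have Wc: "W (smn c k) = {x. \<exists>t. P k x t}" for k unfolding W_def by simp
  \<comment> \<open>One bound \<open>u\<close> serves all nodes, bounds and numbers up to
    \<open>t\<close> at once, so that \<open>h\<close> can be fixed before \<open>p\<close> and the
    node are known.\<close>
  define Q where "Q t u \<longleftrightarrow> (\<forall>a<Suc t. \<forall>b<Suc t. \<forall>x<Suc t. P (pr a b) x (Suc t) \<longrightarrow>
    (\<exists>y<u. conv {} u (smn c (pr a b)) x y))" for t u
  have Q_ex: "\<exists>u. Q t u" for t
  proof -
    have ev: "\<exists>u. \<forall>v\<ge>u. P (pr a b) x (Suc t) \<longrightarrow> (\<exists>y<v. conv {} v (smn c (pr a b)) x y)" for a b x
    proof (cases "P (pr a b) x (Suc t)")
      case True
      then have "x \<in> W (smn c (pr a b))" using Wc by blast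
      then obtain y where "computes {} (smn c (pr a b)) x y" unfolding W_def by blast
      then obtain u where "conv {} u (smn c (pr a b)) x y" using computes_conv by blast
      then show ?thesis using conv_mono conv_less(2) by blast
    qed simp
    have "\<exists>u. \<forall>v\<ge>u. Q t v"
      unfolding Q_def by (rule eventually_bounded, rule eventually_bounded, rule eventually_bounded, rule ev)
    then show ?thesis by blast
  qed
  define h where "h t = (LEAST u. Q t u)" for t
  have Q_h: "Q t (h t)" for t unfolding h_def using Q_ex by (rule LeastI_ex)
  have rec_h: "rec_in {} h"
    unfolding h_def
    by (rule rec_Least[OF _ Q_ex]) (unfold Q_def P_def, intro rec_intros)
  have "\<exists>e. X2 e = - simp_set \<and> (\<forall>x s. x \<in> X2_stage e s \<longrightarrow> x \<notin> {x. tok (p s) x = 1})"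
    if "mono p" "computable_fun p" for p
  proof -
    have "rec_in {} (\<lambda>t. p (h t))" using that(2) rec_h rec_comp unfolding computable_fun_iff_rec_in by blast
    \<comment> \<open>The same index computes \<open>p (h t)\<close> from \<open>simp_set\<close>,
      so the true path turns left at level \<open>n\<close>.\<close>
    from oracle_free_index[OF this] obtain n where n: "\<And>B t. computes B n t (p (h t))" by metis
    define a where "a = true_path n"
    have lft: "true_path (Suc n) = 2 * a" unfolding a_def by (rule total_imp_left) (use n in blast)
    have a2: "0 < 2 * a" unfolding a_def by simp
    obtain s0 where s0: "\<And>s. s0 \<le> s \<Longrightarrow> \<not> left (last_node s) (2 * a)"
      using left_finite[of "Suc n"] unfolding lft by blast
    obtain s1 where s1: "\<And>s x k. s1 \<le> s \<Longrightarrow> req s x \<Longrightarrow> k < Suc n \<Longrightarrow> last_node s \<noteq> true_path k"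
      using req_finite_below by metis
    \<comment> \<open>Tokens of numbers from \<open>b\<close> on exist only after \<open>s0\<close>
      and \<open>s1\<close>, when visits to the left of \<open>2 * a\<close> and requests by the
      nodes above it have ceased.\<close>
    define b where "b = max (2 * a) (max s0 s1)"
    define F where "F = {x. x < b \<and> x \<notin> simp_set}"
    \<comment> \<open>The finite correction below \<open>b\<close> is given by its canonical index,
      which makes \<open>R\<close> decidable.\<close>
    define R where "R x s \<longleftrightarrow> x \<in> set_decode (set_encode F) \<or>
      b \<le> x \<and> anc (2 * a) (last_node s) \<and> x < s \<and> \<not> anc (tok s x) (2 * a)" for x s
    have "dec_in {} (\<lambda>z. R (p1 z) (p2 z))" unfolding R_def by (intro rec_intros)
    then have "ce {x. \<exists>s. R x s}" by (rule ce_Collect_ex)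
    then obtain i where i: "W i = {x. \<exists>s. R x s}" unfolding ce_def by blast
    define j where "j = smn c (pr (2 * a) b)"
    have j: "W j = {x. b \<le> x \<and> (\<exists>t. anc (tok t x) (2 * a))}"
      unfolding j_def Wc P_def by auto
    have "finite F" unfolding F_def by simp
    then have R_iff: "R x s \<longleftrightarrow> x < b \<and> x \<notin> simp_set \<or>
      b \<le> x \<and> anc (2 * a) (last_node s) \<and> x < s \<and> \<not> anc (tok s x) (2 * a)" for x s
      unfolding R_def by (simp add: set_encode_inverse F_def)
    have stays: "anc (tok u x) (2 * a)" if "b \<le> x" "anc (tok t x) (2 * a)" "t \<le> u" for x t u
    proof -
      have t0: "tok t x \<noteq> 0" using that(2) anc_pos by force
      then have "s0 \<le> t" using tok_less[OF t0] that(1) unfolding b_def by simp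
      then show ?thesis using persist[OF t0 that(2) _ that(3)] s0 by simp
    qed
    have pass: "\<exists>s>t. anc (2 * a) (last_node s) \<and> (\<forall>x. anc (tok s x) (2 * a) \<longrightarrow> tok s x = 1)" for t
    proof -
      obtain s where s: "Suc t \<le> s" "anc (2 * a) (last_node s)" "2 * a \<noteq> last_node s"
        using pass_true_path[of "Suc t" "Suc n"] unfolding lft by blast
      have "tok s x = 1" if "anc (tok s x) (2 * a)" for x
        using below_last_tok[of "tok s x" s x] anc_trans[OF that s(2)] that s(2,3) anc_antisym by metis
      then show ?thesis using s(1,2) by (intro exI[of _ s]) auto
    qed
    have big: "x \<in> W i - W j \<longleftrightarrow> x \<notin> simp_set" if "b \<le> x" for x
    proof
      assume "x \<in> W i - W j"
      then have no: "\<not> anc (tok t x) (2 * a)" for t using j that by blast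
      have "tok t x \<noteq> 1" for t
      proof
        assume "tok t x = 1"
        then show False using no[of t] a2 by simp
      qed
      then show "x \<notin> simp_set" unfolding simp_set_def by blast
    next
      assume x: "x \<notin> simp_set"
      \<comment> \<open>A token on the path to \<open>2 * a\<close> stays on it and would be at the
        root at the next visit beyond \<open>2 * a\<close>.\<close>
      have no: "\<not> anc (tok t x) (2 * a)" for t
      proof
        assume at: "anc (tok t x) (2 * a)"
        obtain s where s: "t < s" "\<forall>x. anc (tok s x) (2 * a) \<longrightarrow> tok s x = 1" using pass by blast
        then have "tok s x = 1" using stays[OF \<open>b \<le> x\<close> at, of s] by simp
        then show False using x unfolding simp_set_def by blast
      qed
      obtain s where "x < s" "anc (2 * a) (last_node s)" using pass by blast
      then have "R x s" unfolding R_iff using no \<open>b \<le> x\<close> by blast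
      then show "x \<in> W i - W j" using i j no by blast
    qed
    have small: "x \<in> W i - W j \<longleftrightarrow> x \<notin> simp_set" if "x < b" for x
      using that i j R_iff by auto
    have X2: "X2 (pr i j) = - simp_set" unfolding X2_def using big small by (auto simp: not_less[symmetric])
    have "tok (p s) x \<noteq> 1" if xs: "x \<in> X2_stage (pr i j) s" for x s
    proof
      assume px: "tok (p s) x = 1"
      then have xA: "x \<in> simp_set" unfolding simp_set_def by blast
      have xi: "x \<in> W i" "x \<notin> W_stage j s" using xs W_eq_Union_W_stage unfolding X2_stage_def by auto
      then obtain s2 where "R x s2" using i by blast
      then have R: "b \<le> x" "anc (2 * a) (last_node s2)" "x < s2" "\<not> anc (tok s2 x) (2 * a)"
        using xA unfolding R_iff by auto
      define V where "V t \<longleftrightarrow> anc (tok t x) (2 * a)" for t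
      have VV: "V (p s)" unfolding V_def px using a2 by simp
      \<comment> \<open>The stage of the withdrawal: the token is at \<open>2 * a\<close> or above
        for the first time.\<close>
      define w where "w = (LEAST t. V t)"
      have w: "V w" "\<And>t. t < w \<Longrightarrow> \<not> V t"
        unfolding w_def using LeastI[of V, OF VV] not_less_Least by blast+
      have "s2 < w" using stays[OF R(1), of w s2] w(1) R(4) unfolding V_def by (meson not_le)
      then obtain t0 where t0: "w = Suc t0" "s2 \<le> t0" by (cases w) auto
      have Vt: "anc (tok (Suc t0) x) (2 * a)" "\<not> anc (tok t0 x) (2 * a)"
        using w(1) w(2)[of t0] t0(1) unfolding V_def by auto
      have late: "s0 \<le> t0" "s1 \<le> t0" "x \<le> t0" "2 * a \<le> t0" "b \<le> t0"
        using R(1,3) t0(2) unfolding b_def by auto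
      have req_below: "last_node t = 2 * a" if "s1 \<le> t" "req t x" "anc (last_node t) (2 * a)" for t
      proof -
        have eq: "last_node t = true_path (lev (last_node t))"
          using anc_true_path_eq[of "last_node t" "Suc n"] that(3) unfolding lft by blast
        have "lev (2 * a) = Suc n" using lev_true_path[of "Suc n"] unfolding lft .
        then have "lev (last_node t) \<le> Suc n" using lev_anc[OF that(3)] by simp
        moreover have "\<not> lev (last_node t) < Suc n" using s1[OF that(1,2)] eq by metis
        ultimately show ?thesis using eq lft by (metis le_neq_implies_less)
      qed
      \<comment> \<open>The token enters the path at \<open>2 * a\<close> itself. A higher entry
        would come from the left, which is no longer visited, or from the right, which the visit at
        \<open>s2\<close> excludes.\<close>
      have at_a: "anc (2 * a) (last_node t0) \<and> tok (Suc t0) x = 2 * a"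
      proof (cases rule: tok_step_cases[of t0 x])
        case move
        define e where "e = last_node t0"
        have e: "1 < e" "tok t0 x = e" "anc (e div 2) (2 * a)" "\<not> anc e (2 * a)"
          using move Vt unfolding e_def by auto
        have ce: "e = 2 * (e div 2) \<or> e = 2 * (e div 2) + 1" by presburger
        show ?thesis
        proof (cases "e div 2 = 2 * a")
          case True
          have "anc (2 * a) e" using anc_div2[OF e(1)] True by simp
          then show ?thesis using move(3) True unfolding e_def by simp
        next
          case False
          then consider "anc (2 * (e div 2)) (2 * a)" | "anc (2 * (e div 2) + 1) (2 * a)"
            using anc_child e(3) by blast
          then show ?thesis
          proof cases
            case 1
            then have e': "e = 2 * (e div 2) + 1" using ce e(4) by metis
            then have "left (2 * a) e" unfolding left_iff using 1 e(1)
              by (intro exI[of _ "e div 2"]) (metis anc_refl less_trans zero_less_one)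
            then have l: "left (last_node s2) e" using left_extend1 R(2) by blast
            then have "s2 \<noteq> t0" unfolding e_def by (metis left_irrefl)
            then show ?thesis using tok_visits(1)[of t0 x s2] e(1,2) l R(3) t0(2) by auto
          next
            case 2
            then have e': "e = 2 * (e div 2)" using ce e(4) by metis
            then have "left e (2 * a)" unfolding left_iff using 2 e(1)
              by (intro exI[of _ "e div 2"]) (metis anc_refl less_trans zero_less_one)
            then show ?thesis using s0[OF late(1)] unfolding e_def by blast
          qed
        qed
      next
        case request
        then show ?thesis using req_below[OF late(2) request(1)] Vt(1) a2 by simp
      next
        case cancel then show ?thesis using Vt(1) by simp
      next
        case stay then show ?thesis using Vt by simp
      qed
      have ne1: "2 * a \<noteq> 1" by presburger
      \<comment> \<open>The step by which the token leaves \<open>2 * a\<close>; it has happened by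
        stage \<open>p s\<close>.\<close>
      define M where "M t \<longleftrightarrow> Suc t0 \<le> t \<and> tok t x \<noteq> 2 * a" for t
      have "Suc t0 \<le> p s"
      proof (rule ccontr)
        assume "\<not> Suc t0 \<le> p s"
        then show False using w(2)[of "p s"] VV t0(1) by simp
      qed
      then have MM: "M (p s)" unfolding M_def px using ne1 by metis
      define k where "k = (LEAST t. M t)"
      have k: "M k" "k \<le> p s" "\<And>t. t < k \<Longrightarrow> \<not> M t"
        unfolding k_def using LeastI[of M, OF MM] Least_le[of M, OF MM] not_less_Least by blast+
      have "k \<noteq> Suc t0" using k(1) at_a unfolding M_def by metis
      moreover have "Suc t0 \<le> k" using k(1) unfolding M_def by blast
      ultimately obtain v where v: "k = Suc v" "Suc t0 \<le> v" by (cases k) auto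
      have tv: "tok v x = 2 * a" "tok (Suc v) x \<noteq> 2 * a"
        using k(3)[of v] k(1) v unfolding M_def by auto
      have ev: "last_node v = 2 * a"
      proof (cases rule: tok_step_cases[of v x])
        case move then show ?thesis using tv by simp
      next
        case request
        have "anc (tok (Suc v) x) (2 * a)" using stays[OF R(1) Vt(1), of "Suc v"] v(2) by simp
        then show ?thesis using req_below[of v] request late(2) v(2) by simp
      next
        case cancel then show ?thesis using s0[of v] late(1) v(2) tv(1) by simp
      next
        case stay then show ?thesis using tv by simp
      qed
      have "0 < a" using a2 by simp
      have "anc a (last_node v)" "a \<noteq> last_node v" unfolding ev using \<open>0 < a\<close> by auto
      moreover have "anc (2 * a) (last_node v)" unfolding ev using a2 by simp
      \<comment> \<open>The visit at \<open>t0\<close> makes the guess at \<open>v\<close> wait for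
        the computation at argument \<open>t0\<close>.\<close>
      ultimately have "guess v a" using below_last(2) by blast
      moreover have "t0 < v" "anc (2 * a) (last_node t0)" using v(2) at_a by auto
      ultimately obtain y where y: "y < v" "conv {x. tok v x = 1} v (lev a) t0 y"
        unfolding total_guess_def by blast
      have "lev a = n" unfolding a_def by simp
      then have "y = p (h t0)" using n computes_unique conv_computes[OF y(2)] by metis
      \<comment> \<open>The computed value is smaller than the stage \<open>v\<close>, which
        precedes \<open>p s\<close>. By monotonicity of \<open>p\<close> this gives
        \<open>h t0 \<le> s\<close>, so \<open>x\<close> has left the approximation by stage
        \<open>s\<close>.\<close>
      then have less: "p (h t0) < p s" using y(1) k(2) v(1) by simp
      have "h t0 \<le> s" using less \<open>mono p\<close> by (meson monoD not_le less_le_not_le linorder_le_cases)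
      have "P (pr (2 * a) b) x (Suc t0)" unfolding P_def using R(1) at_a a2 by simp
      then obtain y' where "conv {} (h t0) j x y'"
        using Q_h[of t0] late unfolding Q_def j_def by (meson less_Suc_eq_le)
      then have "run {} (h t0) (program j) x = Some y'" "x < h t0" using conv_run conv_less(1) by blast+
      then have "x \<in> W_stage j (h t0)" unfolding W_stage_def by simp
      then show False using W_stage_mono[OF \<open>h t0 \<le> s\<close>] xi(2) by blast
    qed
    then show ?thesis using X2 by blast
  qed
  then show ?thesis unfolding two_tardy_def using computable_enumeration_tok by blast
qed

text \<open>\<open>visited_inf\<close> is a \<open>\<forall>\<exists>\<close> property of a
  decidable matrix, so two jumps decide it and compute the true path; the path in turn decides the
  totality questions to which \<open>double_jump_totality\<close> reduces membership.\<close>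

lemma low2_simp_set: "turing_le (jump (jump simp_set)) (jump (jump {}))"
proof -
  let ?O = "jump (jump {})"
  have "dec_in {} (\<lambda>z. p2 (p1 z) \<le> p2 z \<and> anc (p1 (p1 z)) (last_node (p2 z)))"
    by (intro rec_intros)
  then have "dec_in (jump {}) (\<lambda>z. \<exists>t. p2 z \<le> t \<and> anc (p1 z) (last_node t))"
    by (rule dec_in_jump_ex)
  then have "dec_in ?O (\<lambda>a. \<exists>s. \<not> (\<exists>t\<ge>s. anc a (last_node t)))"
    by (intro dec_in_jump_ex[of _ "\<lambda>a s. \<not> (\<exists>t\<ge>s. anc a (last_node t))"] dec_not)
  from dec_not[OF this] have vis: "dec_in ?O visited_inf"
    unfolding visited_inf_def by simp
  have path: "rec_in ?O (\<lambda>x. true_path (f x))" if "rec_in ?O f" for f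
  proof -
    have "rec_in ?O (\<lambda>x. rec_nat 1 (\<lambda>_ r. if visited_inf (2 * r) then 2 * r else 2 * r + 1) (f x))"
      by (intro rec_intros dec_comp[OF vis] that)
    moreover have "rec_nat 1 (\<lambda>_ r. if visited_inf (2 * r) then 2 * r else 2 * r + 1) k = true_path k" for k
      by (induction k) simp_all
    ultimately show ?thesis by simp
  qed
  obtain g where g: "rec_in {} g"
    "\<And>e. e \<notin> jump (jump simp_set) \<longleftrightarrow> (\<forall>m. \<exists>y. computes simp_set (g e) m y)"
    using double_jump_totality[of simp_set] by blast
  have g': "rec_in ?O g" using rec_in_empty g(1) .
  have iff: "e \<in> jump (jump simp_set) \<longleftrightarrow> true_path (Suc (g e)) \<noteq> 2 * true_path (g e)" for e
    using g(2) left_imp_total total_imp_left by blast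
  have "dec_in ?O (\<lambda>e. true_path (Suc (g e)) \<noteq> 2 * true_path (g e))"
    by (intro rec_intros path g')
  then show ?thesis unfolding turing_le_iff_dec_in iff .
qed

theorem theorem5p2:
  "\<exists>A :: nat set. ce A \<and> simple_set A \<and> two_tardy A \<and>
     turing_equiv (jump (jump A)) (jump (jump {}))"
  using ce_simp_set simple_simp_set two_tardy_simp_set low2_simp_set
    turing_le_jump[OF turing_le_jump[OF turing_le_empty]]
  unfolding turing_equiv_def by blast

end
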